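(* There exist a constant $K>0$ (independent of $L$) and $L_0>0$ such that for every $L\ge L_0$ the following holds. Let $\omega=\omega_1(L)$ and let $f\in L^2(\mathbb{T}_L)$ be a mass-$1$ maximizer, i.e. $\|f\|_{L^2(\mathbb{T}_L)}=1$ and $\mathcal{Q}(f,f,f,f)=\omega_1(L)$. Then there exist $s_0=s_0(f,L)$ and a constant $C_L$ depending on $L$ such that $$|\hat f(k)|\le C_L\,|k|^{-\log_3\left(\frac{\omega}{2K}L^{1/2}\right)}\qquad\text{for all } k\in\mathbb{Z} \text{ with } |k|>s_0 .$$
   Context: For $L>0$, $\mathbb{T}_L=\mathbb{R}/(L\mathbb{Z})$, with $\|f\|_{L^2(\mathbb{T}_L)}^2=\int_0^L|f(x)|^2\,dx$. Let $e_L(x)=L^{-1/2}e^{2\pi i x/L}$ and, for $f\in L^2(\mathbb{T}_L)$ and $k\in\mathbb{Z}$, $\hat f(k)=\int_{\mathbb{T}_L}f(x)e_L(-kx)\,dx$, so that $f(x)=\sum_{k\in\mathbb{Z}}\hat f(k)e_L(kx)$. $T_r=e^{ir\partial_x^2}$ is the free Schrödinger propagator, $\widehat{T_rf}(k)=e^{-4\pi^2ik^2r/L^2}\hat f(k)$. Define $$\mathcal{Q}(f_1,f_2,f_3,f_4)=\int_0^1\int_{\mathbb{T}_L}\overline{T_rf_1}\,T_rf_2\,\overline{T_rf_3}\,T_rf_4\,dx\,dr,\qquad \omega_1(L)=\max_{\|f\|_{L^2(\mathbb{T}_L)}=1}\mathcal{Q}(f,f,f,f).$$ *)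

theory Defs
  imports "HOL-Analysis.Analysis"
begin

text \<open>
  Functions on the torus \<open>\<real>/(L\<int>)\<close> are represented by \<open>L\<close>-periodic functions on the real line, with
  the period interval \<open>[0, L]\<close> carrying Lebesgue measure. Elements of \<open>L\<^sup>2\<close> are given by Borel
  representatives (every almost-everywhere class has one); all notions below depend only on
  the class.
\<close>

definition L2_torus :: "real \<Rightarrow> (real \<Rightarrow> complex) set" where
  "L2_torus L = {f. f \<in> borel_measurable borel \<and> (\<forall>x. f (x + L) = f x) \<and>
                    set_integrable lborel {0..L} (\<lambda>x. (cmod (f x))\<^sup>2)}"

definition L2_norm :: "real \<Rightarrow> (real \<Rightarrow> complex) \<Rightarrow> real" where
  "L2_norm L f = sqrt (LINT x:{0..L}|lborel. (cmod (f x))\<^sup>2)"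

definition e_torus :: "real \<Rightarrow> real \<Rightarrow> complex" where
  "e_torus L x = complex_of_real (L powr (- 1 / 2)) * exp (\<i> * complex_of_real (2 * pi * x / L))"

definition fourier :: "real \<Rightarrow> (real \<Rightarrow> complex) \<Rightarrow> int \<Rightarrow> complex" where
  "fourier L f k = (LINT x:{0..L}|lborel. f x * e_torus L (- real_of_int k * x))"

text \<open>
  \<open>propagator L r f\<close> is \<open>T\<^sub>r f\<close>. By Riesz-Fischer such a \<open>g\<close> exists for \<open>f\<close> in \<open>L\<^sup>2\<close>, and its Fourier
  coefficients determine it up to a null set.
\<close>

definition propagator :: "real \<Rightarrow> real \<Rightarrow> (real \<Rightarrow> complex) \<Rightarrow> real \<Rightarrow> complex" where
  "propagator L r f = (SOME g. g \<in> L2_torus L \<and>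
     (\<forall>k::int. fourier L g k =
        exp (- \<i> * complex_of_real (4 * pi\<^sup>2 * (real_of_int k)\<^sup>2 * r / L\<^sup>2)) * fourier L f k))"

text \<open>
  The iterated integral is insensitive to the representative chosen in \<^const>\<open>propagator\<close>
  separately for each \<open>r\<close>, since the inner integral depends only on almost-everywhere classes in \<open>x\<close>.
\<close>

definition Q_form :: "real \<Rightarrow> (real \<Rightarrow> complex) \<Rightarrow> (real \<Rightarrow> complex) \<Rightarrow>
    (real \<Rightarrow> complex) \<Rightarrow> (real \<Rightarrow> complex) \<Rightarrow> complex" where
  "Q_form L f1 f2 f3 f4 =
     (LINT r:{0..1}|lborel. (LINT x:{0..L}|lborel.
        cnj (propagator L r f1 x) * propagator L r f2 x *
        cnj (propagator L r f3 x) * propagator L r f4 x))"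

text \<open>
  \<open>Q_form L f f f f\<close> is the integral of \<open>\<bar>T\<^sub>r f\<bar>\<close> to the fourth power, hence real; \<^const>\<open>Re\<close> only adjusts
  the type. The supremum is the maximum as soon as a maximizer exists.
\<close>

definition omega1 :: "real \<Rightarrow> real" where
  "omega1 L = (SUP f\<in>{f \<in> L2_torus L. L2_norm L f = 1}. Re (Q_form L f f f f))"

end

theory Submission
  imports Defs
begin

text \<open>
  On the Fourier side the form is a sum over \<open>(m, k, l)\<close> of
  \<open>a (k + m) * cnj (a k) * cnj (a (l + m)) * a l\<close>, divided by \<open>L\<close>, against the oscillatory integral
  of \<open>cis (- (8 \<pi>\<^sup>2 / L\<^sup>2) m (k - l) r)\<close> over \<open>r \<in> [0, 1]\<close>; that integral is
  \<open>O(1 / (\<bar>m\<bar> \<bar>k - l\<bar>))\<close>, so the sum converges absolutely on \<open>\<ell>\<^sup>2\<close> by AM-GM.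
  Varying one coefficient at a maximizer gives \<open>\<omega> L a j = \<Sum> a (j + m) * cnj (a (j - i + m)) * a (j - i) * osc (m i)\<close>.
  The resonant terms \<open>m = 0\<close> and \<open>i = 0\<close> contribute at most \<open>2 \<bar>a j\<bar>\<close>. In the others one of the three
  indices is at least \<open>\<bar>j\<bar> / 3\<close> in size, while the remaining sum is a convolution of \<open>\<ell>\<^sup>2\<close> sequences and
  vanishes as \<open>j \<rightarrow> \<infinity>\<close>. Hence, as soon as \<open>\<omega> L > 2\<close>, for every \<open>q > 0\<close> the supremum of \<open>\<bar>a\<bar>\<close> beyond \<open>s\<close> is at
  most \<open>q\<close> times the supremum beyond \<open>s / 3\<close> for large \<open>s\<close>, which gives decay faster than any power.
  With \<open>K = 2\<close>, either the claimed exponent is nonnegative and the bound is trivial, or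
  \<open>\<omega> L \<ge> \<omega> * sqrt L > 4\<close>.
\<close>

section \<open>Uniqueness of Fourier coefficients\<close>

text \<open>The threshold \<open>s0\<close> may depend on \<open>f\<close> and \<open>L\<close>, so
  constants may be crude in \<open>L\<close> and only tails of sequences have to be small. The base
  3 of the logarithm reflects that in \<open>j = p + q - r\<close> one of the three frequencies has
  size at least \<open>|j| / 3\<close>. The obstacle lies earlier, in reaching the Fourier side. The
  evolution is a choice of a function with prescribed coefficients, so nothing can be said about it
  before Riesz-Fischer and Parseval. Moreover it is not known to lie in \<open>L^4\<close> at any
  single time: the expansion of its fourth power has to be an identity whose two sides may both
  diverge, and finiteness appears only after integration in time. As its squared modulus is a priori
  merely integrable, uniqueness of Fourier coefficients is required for integrable functions. It is
  obtained by moving from the interval to the unit circle, where polynomials, continuous functions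
  and Borel sets are tested in turn.\<close>

definition torus :: "real \<Rightarrow> real measure" where
  "torus L = restrict_space lborel {0..L}"

definition torus_char :: "real \<Rightarrow> int \<Rightarrow> real \<Rightarrow> complex" where
  "torus_char L k x = cis (2 * pi * (of_int k * x) / L)"

lemma space_torus [simp]: "space (torus L) = {0..L}"
  by (simp add: torus_def space_restrict_space)

lemma measurable_torus [measurable (raw)]:
  "f \<in> borel_measurable borel \<Longrightarrow> f \<in> borel_measurable (torus L)"
  by (simp add: torus_def measurable_restrict_space1)

lemma set_integral_torus: "(LINT x:{0..L}|lborel. f x) = (LINT x|torus L. f x)"
  for f :: "real \<Rightarrow> 'a::{banach, second_countable_topology}"
  by (simp add: torus_def integral_restrict_space set_lebesgue_integral_def)

lemma set_integrable_torus: "set_integrable lborel {0..L} f \<longleftrightarrow> integrable (torus L) f"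
  for f :: "real \<Rightarrow> 'a::{banach, second_countable_topology}"
  by (simp add: torus_def integrable_restrict_space set_integrable_def)

lemma emeasure_torus: "L \<ge> 0 \<Longrightarrow> emeasure (torus L) (space (torus L)) = L"
  by (simp add: torus_def emeasure_restrict_space space_restrict_space)

lemma measure_torus: "L \<ge> 0 \<Longrightarrow> measure (torus L) {0..L} = L"
  using emeasure_torus[of L] by (simp add: measure_def)

lemma finite_measure_torus: "L \<ge> 0 \<Longrightarrow> finite_measure (torus L)"
  by (intro finite_measureI) (metis emeasure_torus ennreal_neq_top infinity_ennreal_def)

lemma char_measurable [measurable]: "torus_char L k \<in> borel_measurable borel"
  unfolding torus_char_def divide_inverse by (intro borel_measurable_continuous_onI continuous_intros)

lemma norm_char [simp]: "cmod (torus_char L k x) = 1"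
  by (simp add: torus_char_def)

lemma char_0 [simp]: "torus_char L 0 x = 1"
  by (simp add: torus_char_def)

lemma char_add: "torus_char L (j + k) x = torus_char L j x * torus_char L k x"
  by (simp add: torus_char_def cis_mult algebra_simps add_divide_distrib)

lemma cnj_char: "cnj (torus_char L k x) = torus_char L (- k) x"
  by (simp add: torus_char_def cis_cnj)

lemma integrable_mult_char:
  assumes "integrable (torus L) f"
  shows "integrable (torus L) (\<lambda>x. f x * torus_char L k x)"
  using assms by (intro Bochner_Integration.integrable_bound[OF assms]) (auto simp: norm_mult)

text \<open>Multiplication by a real-linear function of \<open>torus_char L 1\<close> only shifts Fourier coefficients by one.\<close>

lemma char_coeffs_zero_mult_poly:
  assumes "real_polynomial_function p"
    and "integrable (torus L) f" "\<And>k. (LINT x|torus L. f x * torus_char L k x) = 0"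
  shows "integrable (torus L) (\<lambda>x. f x * of_real (p (torus_char L 1 x))) \<and>
    (\<forall>k. (LINT x|torus L. f x * of_real (p (torus_char L 1 x)) * torus_char L k x) = 0)"
  using assms
proof (induction arbitrary: f rule: real_polynomial_function.induct)
  case (linear h)
  \<comment> \<open>A real-linear form on the plane is \<open>2 * Re (u * z)\<close> for this
    \<open>u\<close>, and on the circle \<open>cnj\<close> turns the character of index 1 into that
    of index -1.\<close>
  define u where "u = (of_real (h 1) - \<i> * of_real (h \<i>)) / 2"
  have h: "of_real (h (torus_char L 1 x)) = u * torus_char L 1 x + cnj u * torus_char L (-1) x" for x
  proof -
    have A: "h z = Re z * h 1 + Im z * h \<i>" for z
    proof -
      have "h z = h (Re z *\<^sub>R 1 + Im z *\<^sub>R \<i>)"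
        by (intro arg_cong[where f = h]) (simp add: complex_eq_iff)
      also have "\<dots> = Re z * h 1 + Im z * h \<i>"
        using linear(1) by (simp add: linear_add linear_scale bounded_linear.linear)
      finally show ?thesis .
    qed
    have B: "of_real (Re z * h 1 + Im z * h \<i>) = u * z + cnj u * cnj z" for z
      by (simp add: u_def complex_eq_iff field_simps)
    have C: "torus_char L (-1) x = cnj (torus_char L 1 x)" by (simp add: cnj_char)
    show ?thesis
      unfolding C A[of "torus_char L 1 x"] by (rule B)
  qed
  have *: "f x * of_real (h (torus_char L 1 x)) * torus_char L k x =
      u * (f x * torus_char L (1 + k) x) + cnj u * (f x * torus_char L (-1 + k) x)" for x k
    unfolding h char_add by (simp add: algebra_simps)
  have i: "integrable (torus L) (\<lambda>x. f x * torus_char L k x)" for k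
    using linear(2) by (rule integrable_mult_char)
  have "integrable (torus L) (\<lambda>x. f x * of_real (h (torus_char L 1 x)))"
    using *[of _ 0] i by simp
  moreover have "(LINT x|torus L. f x * of_real (h (torus_char L 1 x)) * torus_char L k x) = 0" for k
    unfolding * using linear(3) i by simp
  ultimately show ?case by blast
next
  case (const c)
  then show ?case
    by (simp add: mult.assoc mult.left_commute[of _ "of_real c"] integrable_mult_left)
next
  case (add p q)
  have 1: "integrable (torus L) (\<lambda>x. f x * of_real (p (torus_char L 1 x)))"
    "\<And>k. (LINT x|torus L. f x * of_real (p (torus_char L 1 x)) * torus_char L k x) = 0"
    using add.IH(1)[OF add.prems] by auto
  have 2: "integrable (torus L) (\<lambda>x. f x * of_real (q (torus_char L 1 x)))"
    "\<And>k. (LINT x|torus L. f x * of_real (q (torus_char L 1 x)) * torus_char L k x) = 0"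
    using add.IH(2)[OF add.prems] by auto
  show ?case
    using 1 2 by (simp add: distrib_left distrib_right integrable_mult_char)
next
  case (mult p q)
  have 1: "integrable (torus L) (\<lambda>x. f x * of_real (p (torus_char L 1 x)))"
    "\<And>k. (LINT x|torus L. f x * of_real (p (torus_char L 1 x)) * torus_char L k x) = 0"
    using mult.IH(1)[OF mult.prems] by auto
  show ?case
    using mult.IH(2)[OF 1] by (simp add: mult.assoc)
qed

text \<open>Stone-Weierstrass on the unit circle passes from polynomials to continuous functions.
  Testing with functions of the circle point rather than of \<open>x\<close> builds periodicity in,
  so the endpoints 0 and \<open>L\<close> need no gluing.\<close>

lemma char_coeffs_zero_mult_continuous:
  assumes L: "L \<ge> 0" and f: "integrable (torus L) f"
    and z: "\<And>k. (LINT x|torus L. f x * torus_char L k x) = 0"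
    and cont: "continuous_on UNIV (\<phi> :: complex \<Rightarrow> real)"
  shows "(LINT x|torus L. f x * of_real (\<phi> (torus_char L 1 x))) = 0"
proof (rule ccontr)
  let ?I = "LINT x|torus L. f x * of_real (\<phi> (torus_char L 1 x))"
  define N where "N = (LINT x|torus L. norm (f x))"
  assume nz: "?I \<noteq> 0"
  \<comment> \<open>The approximation error is at most \<open>e * N\<close>, which is below half of
    the supposedly nonzero integral; the \<open>+ 1\<close> keeps the denominator positive when
    \<open>N = 0\<close>.\<close>
  define e where "e = norm ?I / (2 * (N + 1))"
  have N: "N \<ge> 0" by (simp add: N_def)
  have e: "e > 0" unfolding e_def using nz N by auto
  obtain p where p: "real_polynomial_function p" "\<And>z. z \<in> sphere 0 1 \<Longrightarrow> \<bar>\<phi> z - p z\<bar> < e"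
    using Stone_Weierstrass_real_polynomial_function[of "sphere 0 1" \<phi> e] e cont
    by (metis compact_sphere continuous_on_subset subset_UNIV)
  have pz: "integrable (torus L) (\<lambda>x. f x * of_real (p (torus_char L 1 x)))"
    "(LINT x|torus L. f x * of_real (p (torus_char L 1 x))) = 0"
    using char_coeffs_zero_mult_poly[OF p(1) f z] by (auto dest: spec[where x = 0])
  have d: "norm (of_real (\<phi> (torus_char L 1 x)) - of_real (p (torus_char L 1 x)) :: complex) \<le> e" for x
    unfolding of_real_diff[symmetric] norm_of_real using p(2)[of "torus_char L 1 x"] by simp
  have m: "\<phi> \<in> borel_measurable borel" "p \<in> borel_measurable borel"
    using cont p(1) by (auto intro!: borel_measurable_continuous_onI
        continuous_on_polymonial_function simp: real_polynomial_function_eq)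
  note [measurable] = m borel_measurable_integrable[OF f]
  have i: "integrable (torus L) (\<lambda>x. f x * (of_real (\<phi> (torus_char L 1 x)) - of_real (p (torus_char L 1 x))))"
    by (rule Bochner_Integration.integrable_bound[OF integrable_mult_right[OF integrable_norm[OF f], of e]])
       (use d e in \<open>auto simp: norm_mult mult.commute[of e] intro!: mult_left_mono\<close>)
  have "?I = (LINT x|torus L. f x * (of_real (\<phi> (torus_char L 1 x)) - of_real (p (torus_char L 1 x)))
      + f x * of_real (p (torus_char L 1 x)))"
    by (simp add: algebra_simps)
  also have "\<dots> = (LINT x|torus L. f x * (of_real (\<phi> (torus_char L 1 x)) - of_real (p (torus_char L 1 x))))"
    using i pz by simp
  also have "norm \<dots> \<le> (LINT x|torus L. e * norm (f x))"
    by (rule Bochner_Integration.integral_norm_bound_integral[OF i integrable_mult_right[OF integrable_norm[OF f]]])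
       (use d e in \<open>auto simp: norm_mult mult.commute[of e] intro!: mult_left_mono\<close>)
  also have "\<dots> = e * N" by (simp add: N_def)
  also have "\<dots> < norm ?I"
    using N nz by (simp add: e_def field_simps add_nonneg_pos)
  finally show False by simp
qed

text \<open>Indicators of open sets are pointwise limits of truncated multiples of the distance to
  the complement. Open sets are stable under intersection and generate the Borel sets, so a Dynkin
  argument gives the rest.\<close>

lemma char_coeffs_zero_set:
  assumes L: "L \<ge> 0" and f: "integrable (torus L) f"
    and z: "\<And>k. (LINT x|torus L. f x * torus_char L k x) = 0"
    and B: "B \<in> sets borel"
  shows "(LINT x|torus L. indicator B (torus_char L 1 x) *\<^sub>R f x) = 0"
proof -
  note [measurable] = borel_measurable_integrable[OF f]
  have i: "integrable (torus L) (\<lambda>x. indicator B (torus_char L 1 x) *\<^sub>R f x)" if "B \<in> sets borel" for B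
    using that by (intro Bochner_Integration.integrable_bound[OF f]) (auto simp: indicator_def)
  have op: "(LINT x|torus L. indicator U (torus_char L 1 x) *\<^sub>R f x) = 0" if U: "open U" for U
  \<comment> \<open>The distance to an empty complement is 0 by convention, so the cut-offs below
    would vanish identically; for the whole plane the claim is the coefficient of index 0.\<close>
  proof (cases "U = UNIV")
    case True
    then show ?thesis using z[of 0] by simp
  next
    case False
    define \<phi> where "\<phi> n z = min 1 (real n * infdist z (- U))" for n z
    have lim: "(\<lambda>n. \<phi> n z) \<longlonglongrightarrow> indicator U z" for z
    proof (cases "z \<in> U")
      case True
      have "infdist z (- U) > 0"
        using in_closed_iff_infdist_zero[of "- U" z] U False True infdist_nonneg[of z "- U"] 
        by (auto simp: less_le)
      then have "\<forall>\<^sub>F n in sequentially. real n * infdist z (- U) \<ge> 1"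
        by real_asymp
      then have "\<forall>\<^sub>F n in sequentially. \<phi> n z = 1"
        by eventually_elim (simp add: \<phi>_def)
      then show ?thesis using True by (simp add: tendsto_eventually)
    next
      case False
      then show ?thesis by (simp add: \<phi>_def)
    qed
    have [measurable]: "U \<in> sets borel" using U by simp
    have c: "continuous_on UNIV (\<phi> n)" for n
      unfolding \<phi>_def by (intro continuous_intros)
    have [measurable]: "\<phi> n \<in> borel_measurable borel" for n
      using c by (rule borel_measurable_continuous_onI)
    have "(\<lambda>n. LINT x|torus L. f x * of_real (\<phi> n (torus_char L 1 x)))
        \<longlonglongrightarrow> (LINT x|torus L. indicator U (torus_char L 1 x) *\<^sub>R f x)"
    proof (rule integral_dominated_convergence[where w = "\<lambda>x. norm (f x)"])
      show "AE x in torus L. (\<lambda>n. f x * of_real (\<phi> n (torus_char L 1 x))) \<longlonglongrightarrow> indicator U (torus_char L 1 x) *\<^sub>R f x"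
      proof (intro AE_I2)
        fix x
        have "(\<lambda>n. f x * of_real (\<phi> n (torus_char L 1 x))) \<longlonglongrightarrow> f x * of_real (indicator U (torus_char L 1 x))"
          by (intro tendsto_intros lim)
        then show "(\<lambda>n. f x * of_real (\<phi> n (torus_char L 1 x))) \<longlonglongrightarrow> indicator U (torus_char L 1 x) *\<^sub>R f x"
          by (simp add: scaleR_conv_of_real mult.commute)
      qed
      have "\<bar>\<phi> n z\<bar> \<le> 1" for n z
        by (auto simp: \<phi>_def min_def infdist_nonneg abs_mult)
      then show "AE x in torus L. norm (f x * of_real (\<phi> n (torus_char L 1 x))) \<le> norm (f x)" for n
        by (simp add: norm_mult mult_left_le)
    qed (use f U in auto)
    then show ?thesis
      unfolding char_coeffs_zero_mult_continuous[OF L f z c] by (simp add: LIMSEQ_const_iff)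
  qed
  have "sigma_sets UNIV {U :: complex set. open U} = sets borel"
    by (simp add: borel_def)
  then have sg: "B \<in> sigma_sets UNIV {U :: complex set. open U}" using B by simp
  have "Int_stable {U :: complex set. open U}" "{U :: complex set. open U} \<subseteq> Pow UNIV"
    by (auto simp: Int_stable_def)
  from this sg show ?thesis
  proof (induction rule: sigma_sets_induct_disjoint)
    case (basic A)
    then show ?case using op by auto
  next
    case empty
    then show ?case by simp
  next
    case (compl A)
    then have A: "A \<in> sets borel" by (simp add: borel_def)
    have "(LINT x|torus L. indicator (UNIV - A) (torus_char L 1 x) *\<^sub>R f x) =
        (LINT x|torus L. indicator UNIV (torus_char L 1 x) *\<^sub>R f x - indicator A (torus_char L 1 x) *\<^sub>R f x)"
      by (intro Bochner_Integration.integral_cong) (auto simp: indicator_def)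
    also have "\<dots> = 0"
      using i[of UNIV] i[OF A] op[of UNIV] compl by simp
    finally show ?case .
  next
    case (union A)
    then have A: "A n \<in> sets borel" for n by (auto simp: borel_def)
    have S: "{x \<in> space (torus L). torus_char L 1 x \<in> A n} \<in> sets (torus L)" for n
      using A by measurable
    let ?S = "\<lambda>n. {x \<in> space (torus L). torus_char L 1 x \<in> A n}"
    have eq: "(LINT x|torus L. indicator B (torus_char L 1 x) *\<^sub>R f x) =
        (LINT x:{x \<in> space (torus L). torus_char L 1 x \<in> B}|torus L. f x)" for B
      unfolding set_lebesgue_integral_def
      by (intro Bochner_Integration.integral_cong) (auto simp: indicator_def)
    have "(LINT x:(\<Union>n. ?S n)|torus L. f x) = (\<Sum>n. LINT x:?S n|torus L. f x)"
    proof (rule lebesgue_integral_countable_add[OF S])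
      show "i \<noteq> j \<Longrightarrow> ?S i \<inter> ?S j = {}" for i j
        using union.hyps(1) by (auto simp: disjoint_family_on_def)
      show "set_integrable (torus L) (\<Union>n. ?S n) f"
        unfolding set_integrable_def using S
        by (intro integrable_mult_indicator f) auto
    qed
    moreover have "(\<Union>n. ?S n) = {x \<in> space (torus L). torus_char L 1 x \<in> (\<Union>n. A n)}" by auto
    moreover have "(LINT x:?S n|torus L. f x) = 0" for n
      using union.IH[of n] unfolding eq .
    ultimately show ?case unfolding eq by simp
  qed
qed

text \<open>\<open>Arg2pi\<close> jumps across the positive real axis but takes the smaller value
  there, so it is lower semicontinuous and its strict superlevel sets are open.\<close>

lemma Arg2pi_measurable [measurable]: "Arg2pi \<in> borel_measurable borel"
  by (rule borel_measurable_iff_greater[THEN iffD2]) (auto simp: open_Arg2pi2pi_gt)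

lemma char_coeffs_zero_AE_Re:
  assumes L: "L > 0" and f: "integrable (torus L) f"
    and z: "\<And>k. (LINT x|torus L. f x * torus_char L k x) = 0"
  shows "AE x in torus L. Re (f x) \<le> 0"
proof -
  note [measurable] = borel_measurable_integrable[OF f]
  have "{x \<in> space (torus L). Re (f x) > 0} \<in> sets (torus L)" by measurable
  then have A: "{x. 0 \<le> x \<and> x \<le> L \<and> Re (f x) > 0} \<in> sets borel" (is "?A \<in> _")
    by (auto simp: torus_def sets_restrict_space_iff)
  \<comment> \<open>\<open>Arg2pi\<close> inverts the parametrisation of the circle on
    \<open>[0, L)\<close>, so the set where \<open>Re (f x)\<close> is positive becomes a Borel set
    of the plane. The endpoint \<open>L\<close>, which has the same image as 0, is discarded as a
    null set.\<close>
  define B where "B = {w. L / (2 * pi) * Arg2pi w \<in> ?A}"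
  have B: "B \<in> sets borel"
    using A unfolding B_def by (measurable)
  have AL: "AE x in torus L. x \<noteq> L"
    unfolding torus_def by (subst AE_restrict_space_iff) (use AE_lborel_singleton[of L] in auto)
  have "AE x in torus L. x \<in> {0..L}"
    by (metis AE_space space_torus)
  with AL have key: "AE x in torus L. torus_char L 1 x \<in> B \<longleftrightarrow> Re (f x) > 0"
  proof eventually_elim
    case (elim x)
    have "Arg2pi (torus_char L 1 x) = 2 * pi * x / L"
      by (rule Arg2pi_unique[of 1]) (use elim L in \<open>auto simp: torus_char_def cis_conv_exp field_simps\<close>)
    then show ?case using elim L by (auto simp: B_def)
  qed
  have m[measurable]: "(\<lambda>x. indicator B (torus_char L 1 x) :: real) \<in> borel_measurable (torus L)"
    using B by measurable
  have i: "integrable (torus L) (\<lambda>x. indicator B (torus_char L 1 x) *\<^sub>R f x)"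
    using m by (intro Bochner_Integration.integrable_bound[OF f]) (measurable, auto simp: indicator_def)
  have "(LINT x|torus L. Re (indicator B (torus_char L 1 x) *\<^sub>R f x)) = 0"
    using char_coeffs_zero_set[OF _ f z B] L i by (subst integral_Re) auto
  moreover have "AE x in torus L. 0 \<le> Re (indicator B (torus_char L 1 x) *\<^sub>R f x)"
    using key by eventually_elim (auto simp: indicator_def)
  moreover have "integrable (torus L) (\<lambda>x. Re (indicator B (torus_char L 1 x) *\<^sub>R f x))"
    using i by (rule integrable_Re)
  ultimately have "AE x in torus L. Re (indicator B (torus_char L 1 x) *\<^sub>R f x) = 0"
    by (subst (asm) integral_nonneg_eq_0_iff_AE) auto
  with key show ?thesis
    by eventually_elim (auto simp: indicator_def)
qed

theorem char_coeffs_zero_AE: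
  assumes L: "L > 0" and f: "integrable (torus L) f"
    and z: "\<And>k. (LINT x|torus L. f x * torus_char L k x) = 0"
  shows "AE x in torus L. f x = 0"
proof -
  have "AE x in torus L. Re (u * f x) \<le> 0" for u
    by (rule char_coeffs_zero_AE_Re[OF L]) (use f z in \<open>auto simp: mult.assoc\<close>)
  from this[of 1] this[of "-1"] this[of \<i>] this[of "-\<i>"] show ?thesis
    by eventually_elim (simp add: complex_eq_iff)
qed

section \<open>Square-integrable functions on the torus\<close>

definition basis :: "real \<Rightarrow> int \<Rightarrow> real \<Rightarrow> complex" where
  "basis L k x = e_torus L (of_int k * x)"

text \<open>Square integrability over one period, without periodicity or measurability on the whole
  line: Fourier coefficients see only \<open>{0..L}\<close>.\<close>

definition sqint :: "real \<Rightarrow> (real \<Rightarrow> complex) \<Rightarrow> bool" where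
  "sqint L f \<longleftrightarrow> f \<in> borel_measurable (torus L) \<and> integrable (torus L) (\<lambda>x. (cmod (f x))\<^sup>2)"

lemma basis_char:
  assumes "L > 0" shows "basis L k x = torus_char L k x / of_real (sqrt L)"
proof -
  have "L powr (- 1 / 2) = 1 / sqrt L"
    using assms by (simp add: powr_minus_divide powr_half_sqrt)
  then show ?thesis
    by (simp add: basis_def e_torus_def torus_char_def cis_conv_exp mult_ac)
qed

lemma basis_measurable [measurable]: "basis L k \<in> borel_measurable borel"
  unfolding basis_def e_torus_def divide_inverse
  by (intro borel_measurable_continuous_onI continuous_intros)

lemma fourier_basis: "fourier L f k = (LINT x|torus L. f x * cnj (basis L k x))"
  unfolding fourier_def set_integral_torus basis_def e_torus_def by (simp add: exp_cnj)

lemma fourier_char: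
  assumes "L > 0"
  shows "fourier L f k = (LINT x|torus L. f x * torus_char L (- k) x) / of_real (sqrt L)"
  using assms by (simp add: fourier_basis basis_char cnj_char flip: integral_divide_zero)

lemma basis_periodic:
  assumes "L > 0" shows "basis L k (x + L) = basis L k x"
proof -
  have "2 * pi * (of_int k * (x + L)) / L = 2 * pi * (of_int k * x) / L + 2 * pi * of_int k"
    using assms by (simp add: field_simps)
  moreover have "cis (2 * pi * of_int k) = 1"
    by (rule cis_multiple_2pi) simp
  ultimately show ?thesis
    using assms by (simp add: basis_char torus_char_def flip: cis_mult)
qed

lemma norm_basis: "L > 0 \<Longrightarrow> cmod (basis L k x) = 1 / sqrt L"
  by (simp add: basis_char norm_divide)

lemma integral_cis:
  assumes "L \<ge> 0" "a \<noteq> 0"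
  shows "(LINT x|torus L. cis (a * x)) = (cis (a * L) - 1) / (\<i> * of_real a)"
proof -
  have "(LINT x|lborel. indicator {0..L} x *\<^sub>R cis (a * x)) =
      cis (a * L) / (\<i> * of_real a) - cis (a * 0) / (\<i> * of_real a)"
  proof (rule integral_FTC_atLeastAtMost)
    show "continuous_on {0..L} (\<lambda>x. cis (a * x))" by (intro continuous_intros)
    have "((\<lambda>x. exp (\<i> * of_real a * of_real x) / (\<i> * of_real a)) has_vector_derivative 
        exp (\<i> * of_real a * of_real x)) (at x within {0..L})" for x
      by (rule has_vector_derivative_real_field) (use assms in \<open>auto intro!: derivative_eq_intros\<close>)
    then show "((\<lambda>x. cis (a * x) / (\<i> * of_real a)) has_vector_derivative cis (a * x)) (at x within {0..L})" for x
      by (simp add: cis_conv_exp mult.assoc)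
  qed (use assms in auto)
  then show ?thesis
    by (simp add: set_integral_torus[symmetric] set_lebesgue_integral_def diff_divide_distrib)
qed

lemma basis_orthonormal:
  assumes L: "L > 0"
  shows "fourier L (basis L j) k = (if j = k then 1 else 0)"
proof -
  have "(LINT x|torus L. torus_char L n x) = (if n = 0 then of_real L else 0)" for n
  proof (cases "n = 0")
    case True
    then show ?thesis using L by (simp add: measure_torus scaleR_conv_of_real)
  next
    case False
    define a where "a = 2 * pi * of_int n / L"
    have a: "a \<noteq> 0" using False L by (simp add: a_def)
    have "torus_char L n x = cis (a * x)" for x by (simp add: torus_char_def a_def mult_ac)
    moreover have "cis (a * L) = 1"
      unfolding a_def using L by (simp add: cis_multiple_2pi)
    ultimately show ?thesis
      using False L integral_cis[OF _ a, of L] by simp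
  qed
  then have "(LINT x|torus L. torus_char L (j - k) x) = (if j = k then of_real L else 0)" by simp
  moreover have "complex_of_real L = of_real (sqrt L) * of_real (sqrt L)"
    using L by (simp flip: of_real_mult)
  moreover have "basis L j x * torus_char L (- k) x = torus_char L (j - k) x / of_real (sqrt L)" for x
    using L char_add[of L j "- k" x] by (simp add: basis_char)
  ultimately show ?thesis
    using L unfolding fourier_char[OF L] by (auto simp: integral_divide_zero)
qed

lemma sqintD [dest]:
  assumes "sqint L f"
  shows "f \<in> borel_measurable (torus L)" "integrable (torus L) (\<lambda>x. (cmod (f x))\<^sup>2)"
  using assms by (auto simp: sqint_def)

lemma cmod_mult_le_squares: "cmod (z * w) \<le> (cmod z)\<^sup>2 + (cmod w)\<^sup>2"
proof -
  have "cmod (z * w) \<le> 2 * cmod z * cmod w" by (simp add: norm_mult)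
  then show ?thesis using sum_squares_bound[of "cmod z" "cmod w"] by linarith
qed

lemma cnj_measurable [measurable]: "cnj \<in> borel_measurable borel"
  by (intro borel_measurable_continuous_onI continuous_intros)

lemma sqint_mult_integrable:
  assumes "sqint L f" "sqint L g"
  shows "integrable (torus L) (\<lambda>x. f x * g x)" "integrable (torus L) (\<lambda>x. f x * cnj (g x))"
proof -
  note [measurable] = assms[THEN sqintD(1)]
  have i: "integrable (torus L) (\<lambda>x. (cmod (f x))\<^sup>2 + (cmod (g x))\<^sup>2)"
    using assms by auto
  show "integrable (torus L) (\<lambda>x. f x * g x)"
    by (rule Bochner_Integration.integrable_bound[OF i])
      (auto intro: order.trans[OF cmod_mult_le_squares])
  show "integrable (torus L) (\<lambda>x. f x * cnj (g x))"
    by (rule Bochner_Integration.integrable_bound[OF i])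
      (use order.trans[OF _ cmod_mult_le_squares] in \<open>auto simp: norm_mult\<close>)
qed

lemma sqint_bounded:
  assumes "L > 0" "f \<in> borel_measurable (torus L)" "\<And>x. cmod (f x) \<le> B"
  shows "sqint L f"
proof -
  interpret finite_measure "torus L" using assms by (simp add: finite_measure_torus)
  have "(cmod (f x))\<^sup>2 \<le> B\<^sup>2" for x
    using assms(3) by (intro power_mono) auto
  then show ?thesis
    using assms unfolding sqint_def by (auto intro!: integrable_const_bound[where B = "B\<^sup>2"])
qed

lemma sqint_basis: "L > 0 \<Longrightarrow> sqint L (basis L k)"
  by (rule sqint_bounded[where B = "1 / sqrt L"]) (auto simp: norm_basis)

lemma sqint_integrable:
  assumes "L > 0" "sqint L f" shows "integrable (torus L) f"
  using sqint_mult_integrable(1)[OF assms(2) sqint_bounded[of L "\<lambda>_. 1" 1]] assms by simp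

lemma sqint_add:
  assumes "sqint L f" "sqint L g" shows "sqint L (\<lambda>x. f x + g x)"
proof -
  note [measurable] = assms[THEN sqintD(1)]
  have i: "integrable (torus L) (\<lambda>x. 2 * (cmod (f x))\<^sup>2 + 2 * (cmod (g x))\<^sup>2)"
    using assms[THEN sqintD(2)] by auto
  have "(cmod (z + w))\<^sup>2 \<le> 2 * (cmod z)\<^sup>2 + 2 * (cmod w)\<^sup>2" for z w
  proof -
    have "(cmod (z + w))\<^sup>2 \<le> (cmod z + cmod w)\<^sup>2" by (intro power_mono norm_triangle_ineq) auto
    then show ?thesis using sum_squares_bound[of "cmod z" "cmod w"] by (simp add: power2_sum)
  qed
  then have "integrable (torus L) (\<lambda>x. (cmod (f x + g x))\<^sup>2)"
    by (intro Bochner_Integration.integrable_bound[OF i]) auto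
  then show ?thesis by (simp add: sqint_def)
qed

lemma sqint_cmult:
  assumes "sqint L f" shows "sqint L (\<lambda>x. c * f x)"
proof -
  note [measurable] = assms[THEN sqintD(1)]
  show ?thesis using assms by (auto simp: sqint_def norm_mult power_mult_distrib)
qed

lemma sqint_sum:
  assumes "finite F" "\<And>k. k \<in> F \<Longrightarrow> sqint L (f k)" shows "sqint L (\<lambda>x. \<Sum>k\<in>F. f k x)"
  using assms by (induction F) (auto intro: sqint_add simp: sqint_def[of _ "\<lambda>_. 0"])

lemma sqint_char:
  assumes "sqint L f" shows "sqint L (\<lambda>x. f x * torus_char L k x)"
proof -
  note [measurable] = assms[THEN sqintD(1)]
  show ?thesis using assms by (auto simp: sqint_def norm_mult)
qed

lemma L2_torus_sqint: "f \<in> L2_torus L \<Longrightarrow> sqint L f"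
  by (auto simp: L2_torus_def sqint_def set_integrable_torus measurable_torus)

lemma fourier_add:
  assumes "L > 0" "sqint L f" "sqint L g"
  shows "fourier L (\<lambda>x. f x + g x) k = fourier L f k + fourier L g k"
  using assms by (simp add: fourier_basis distrib_right sqint_mult_integrable sqint_basis)

lemma fourier_cmult: "fourier L (\<lambda>x. c * f x) k = c * fourier L f k"
  by (simp add: fourier_basis mult.assoc)

lemma fourier_sum:
  assumes "L > 0" "finite F" "\<And>k. k \<in> F \<Longrightarrow> sqint L (f k)"
  shows "fourier L (\<lambda>x. \<Sum>j\<in>F. f j x) k = (\<Sum>j\<in>F. fourier L (f j) k)"
  using assms by (simp add: fourier_basis sum_distrib_right sqint_mult_integrable sqint_basis
      Bochner_Integration.integral_sum)

definition trig_poly :: "real \<Rightarrow> int set \<Rightarrow> (int \<Rightarrow> complex) \<Rightarrow> real \<Rightarrow> complex" where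
  "trig_poly L F c x = (\<Sum>k\<in>F. c k * basis L k x)"

lemma trig_poly_measurable [measurable]: "trig_poly L F c \<in> borel_measurable borel"
  unfolding trig_poly_def by measurable

lemma sqint_trig_poly: "L > 0 \<Longrightarrow> sqint L (trig_poly L F c)"
  unfolding trig_poly_def by (cases "finite F") (auto intro!: sqint_sum sqint_cmult sqint_basis sqint_bounded)

lemma fourier_trig_poly:
  assumes "L > 0" "finite F"
  shows "fourier L (trig_poly L F c) k = (if k \<in> F then c k else 0)"
  unfolding trig_poly_def using assms
  by (subst fourier_sum) (auto intro!: sqint_cmult sqint_basis simp: fourier_cmult basis_orthonormal if_distrib cong: if_cong)

lemma inner_trig_poly:
  assumes "L > 0" "sqint L f" "finite F"
  shows "(LINT x|torus L. f x * cnj (trig_poly L F c x)) = (\<Sum>k\<in>F. fourier L f k * cnj (c k))"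
proof -
  have "(LINT x|torus L. f x * cnj (trig_poly L F c x)) =
      (LINT x|torus L. (\<Sum>k\<in>F. cnj (c k) * (f x * cnj (basis L k x))))"
    by (simp add: trig_poly_def sum_distrib_left mult_ac)
  also have "\<dots> = (\<Sum>k\<in>F. cnj (c k) * fourier L f k)"
    using assms by (subst Bochner_Integration.integral_sum)
      (auto simp: fourier_basis intro!: integrable_mult_right sqint_mult_integrable sqint_basis)
  finally show ?thesis by (simp add: mult.commute)
qed

lemma trig_poly_norm:
  assumes "L > 0" "finite F"
  shows "(LINT x|torus L. (cmod (trig_poly L F c x))\<^sup>2) = (\<Sum>k\<in>F. (cmod (c k))\<^sup>2)"
proof -
  have "complex_of_real (LINT x|torus L. (cmod (trig_poly L F c x))\<^sup>2) =
      (LINT x|torus L. trig_poly L F c x * cnj (trig_poly L F c x))"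
    unfolding complex_norm_square[symmetric] by (simp flip: integral_complex_of_real)
  also have "\<dots> = (\<Sum>k\<in>F. c k * cnj (c k))"
    using assms by (simp add: inner_trig_poly sqint_trig_poly fourier_trig_poly)
  also have "\<dots> = complex_of_real (\<Sum>k\<in>F. (cmod (c k))\<^sup>2)"
    unfolding complex_norm_square[symmetric] by simp
  finally show ?thesis by (simp only: of_real_eq_iff)
qed

lemma bessel:
  assumes L: "L > 0" and f: "sqint L f" and F: "finite F"
  shows "(\<Sum>k\<in>F. (cmod (fourier L f k))\<^sup>2) \<le> (LINT x|torus L. (cmod (f x))\<^sup>2)"
proof -
  let ?S = "trig_poly L F (fourier L f)"
  have S: "sqint L ?S" using L by (rule sqint_trig_poly)
  have "0 \<le> (LINT x|torus L. (cmod (f x - ?S x))\<^sup>2)" by simp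
  also have "\<dots> = (LINT x|torus L. (cmod (f x))\<^sup>2 - 2 * Re (f x * cnj (?S x)) + (cmod (?S x))\<^sup>2)"
    by (simp only: cmod_power2) (simp add: power2_eq_square algebra_simps)
  also have "\<dots> = (LINT x|torus L. (cmod (f x))\<^sup>2) - 2 * Re (LINT x|torus L. f x * cnj (?S x))
      + (LINT x|torus L. (cmod (?S x))\<^sup>2)"
    using f S sqint_mult_integrable(2)[OF f S] sqintD(2)[OF f] sqintD(2)[OF S] by (simp add: integral_Re del: times_complex.sel)
  also have "\<dots> = (LINT x|torus L. (cmod (f x))\<^sup>2) - (\<Sum>k\<in>F. (cmod (fourier L f k))\<^sup>2)"
    using L f F by (simp add: inner_trig_poly trig_poly_norm flip: cmod_power2 complex_norm_square)
  finally show ?thesis by simp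
qed

lemma fourier_square_summable:
  assumes "L > 0" "sqint L f"
  shows "(\<lambda>k. (cmod (fourier L f k))\<^sup>2) summable_on UNIV"
  using bessel[OF assms]
  by (intro nonneg_bdd_above_summable_on) (auto intro!: bdd_aboveI2)

section \<open>Riesz--Fischer and Parseval\<close>

lemma AE_summable_of_integrals:
  fixes f :: "nat \<Rightarrow> 'a \<Rightarrow> real"
  assumes i: "\<And>n. integrable M (f n)" and nn: "\<And>n x. f n x \<ge> 0"
    and s: "summable (\<lambda>n. LINT x|M. f n x)"
  shows "AE x in M. summable (\<lambda>n. f n x)"
proof -
  note [measurable] = borel_measurable_integrable[OF i]
  have "(\<integral>\<^sup>+x. (\<Sum>n. ennreal (f n x)) \<partial>M) = (\<Sum>n. \<integral>\<^sup>+x. ennreal (f n x) \<partial>M)"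
    by (intro nn_integral_suminf) measurable
  also have "\<dots> = (\<Sum>n. ennreal (LINT x|M. f n x))"
    using i nn by (intro suminf_cong nn_integral_eq_integral) auto
  also have "\<dots> < \<infinity>"
    using s nn by (simp add: suminf_ennreal2 integral_nonneg)
  finally have "AE x in M. (\<Sum>n. ennreal (f n x)) \<noteq> \<infinity>"
    by (intro nn_integral_PInf_AE) auto
  then show ?thesis
    by eventually_elim (auto intro!: summable_suminf_not_top nn)
qed

text \<open>Replaces an unordered sum by an increasing sequence of partial sums with geometric
  remainders. The rate 1/4 leaves room for weights \<open>2 ^ n\<close>, and the intervals guarantee
  that each index is eventually included.\<close>

lemma exhausting_finite_sets:
  fixes w :: "int \<Rightarrow> real"
  assumes s: "w summable_on UNIV" and nn: "\<And>k. w k \<ge> 0"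
  obtains F :: "nat \<Rightarrow> int set" where "\<And>n. finite (F n)" "incseq F" "\<And>n. {- int n..int n} \<subseteq> F n"
    "\<And>n. sum w (F n) \<le> infsum w UNIV" "\<And>n. infsum w UNIV \<le> sum w (F n) + (1 / 4) ^ n"
proof -
  have "\<exists>G. finite G \<and> dist (sum w G) (infsum w UNIV) \<le> (1 / 4) ^ n" for n
    using infsum_finite_approximation[OF s, of "(1 / 4) ^ n"] by auto
  then obtain G where G: "\<And>n. finite (G n)" "\<And>n. dist (sum w (G n)) (infsum w UNIV) \<le> (1 / 4) ^ n"
    by metis
  define F where "F n = (\<Union>i\<le>n. G i \<union> {- int i..int i})" for n
  have fin: "finite (F n)" for n using G by (auto simp: F_def)
  have "sum w (G n) \<le> sum w (F n)" for n
    using fin nn by (intro sum_mono2) (auto simp: F_def)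
  then have "infsum w UNIV \<le> sum w (F n) + (1 / 4) ^ n" for n
    using G(2)[of n] abs_le_D2[of "sum w (G n) - infsum w UNIV" "(1 / 4) ^ n"]
    unfolding dist_real_def by (smt (verit))
  moreover have "sum w (F n) \<le> infsum w UNIV" for n
    by (rule finite_sum_le_infsum) (use s nn fin in auto)
  moreover have "incseq F"
    unfolding F_def incseq_def using order.trans by (intro allI impI UN_mono) auto
  moreover have "{- int n..int n} \<subseteq> F n" for n by (auto simp: F_def)
  ultimately show ?thesis using fin that by blast
qed

text \<open>The subsequence proof of completeness, carried out by hand so that the limit is a Borel
  function that is periodic at every point, as \<open>L2_torus\<close> demands.\<close>

theorem riesz_fischer:
  assumes L: "L > 0" and c: "(\<lambda>k. (cmod (c k))\<^sup>2) summable_on UNIV"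
  obtains g where "g \<in> L2_torus L" "\<And>k. fourier L g k = c k"
    "(LINT x|torus L. (cmod (g x))\<^sup>2) = (\<Sum>\<^sub>\<infinity>k. (cmod (c k))\<^sup>2)"
proof -
  define w where "w k = (cmod (c k))\<^sup>2" for k
  have wnn: "w k \<ge> 0" for k by (simp add: w_def)
  obtain F where F: "\<And>n. finite (F n)" "incseq F" "\<And>n. {- int n..int n} \<subseteq> F n"
    "\<And>n. sum w (F n) \<le> infsum w UNIV" "\<And>n. infsum w UNIV \<le> sum w (F n) + (1 / 4) ^ n"
    using exhausting_finite_sets[of w] c unfolding w_def by (metis zero_le_power2)
  define S where "S n = trig_poly L (F n) c" for n
  define D where "D n = trig_poly L (F (Suc n) - F n) c" for n
  have [measurable]: "S n \<in> borel_measurable borel" "D n \<in> borel_measurable borel" for n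
    by (simp_all add: S_def D_def)
  have sub: "F n \<subseteq> F (Suc n)" for n using F(2) by (simp add: incseq_SucD)
  have SD: "S (Suc n) x = S n x + D n x" for n x
    using sum.subset_diff[OF sub[of n] F(1)[of "Suc n"], of "\<lambda>k. c k * basis L k x"]
    by (simp add: S_def D_def trig_poly_def)
  then have S_sum: "S n x = S 0 x + (\<Sum>i<n. D i x)" for n x
    by (induction n) auto
  have Dn: "(LINT x|torus L. (cmod (D n x))\<^sup>2) \<le> (1 / 4) ^ n" for n
  proof -
    have "(LINT x|torus L. (cmod (D n x))\<^sup>2) = sum w (F (Suc n) - F n)"
      unfolding D_def w_def using L F(1) by (simp add: trig_poly_norm)
    also have "\<dots> = sum w (F (Suc n)) - sum w (F n)"
      using F(1) sub by (simp add: sum_diff)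
    finally show ?thesis using F(4)[of "Suc n"] F(5)[of n] by simp
  qed
  \<comment> \<open>The squared norms of the increments are at most \<open>(1/4) ^ n\<close>, so the
    weight \<open>2 ^ n\<close> keeps the integrals summable; Cauchy-Schwarz against
    \<open>(1/2) ^ n\<close> then bounds the sum of the increments pointwise.\<close>
  define h where "h n x = 2 ^ n * (cmod (D n x))\<^sup>2" for n x
  have sqD: "sqint L (D n)" and sqS: "sqint L (S n)" for n
    using L by (simp_all add: D_def S_def sqint_trig_poly)
  have hi: "integrable (torus L) (h n)" for n
    unfolding h_def using sqintD(2)[OF sqD] by (intro integrable_mult_right)
  have hnn: "h n x \<ge> 0" for n x by (simp add: h_def)
  have hs: "summable (\<lambda>n. LINT x|torus L. h n x)"
  proof (rule summable_comparison_test')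
    show "summable (\<lambda>n. (1 / 2 :: real) ^ n)" by simp
    fix n
    have "(LINT x|torus L. h n x) = 2 ^ n * (LINT x|torus L. (cmod (D n x))\<^sup>2)"
      by (simp add: h_def)
    also have "\<dots> \<le> 2 ^ n * (1 / 4) ^ n" using Dn by (intro mult_left_mono) auto
    also have "\<dots> = (1 / 2) ^ n" by (simp flip: power_mult_distrib)
    finally show "norm (LINT x|torus L. h n x) \<le> (1 / 2) ^ n"
      using hnn by (simp add: integral_nonneg)
  qed
  have AEs: "AE x in torus L. summable (\<lambda>n. h n x)"
    by (rule AE_summable_of_integrals[OF hi hnn hs])
  define H where "H x = (\<Sum>n. h n x)" for x
  have Hi: "integrable (torus L) H"
    unfolding H_def by (rule integrable_suminf[OF hi]) (use AEs hs hnn in auto)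
  \<comment> \<open>An integrable majorant of all squared partial sums: one factor 2 comes from
    squaring a sum of two terms, and in the 4 another from the geometric series of ratio
    1/2.\<close>
  define W where "W x = 2 * (cmod (S 0 x))\<^sup>2 + 4 * H x" for x
  have Wi: "integrable (torus L) W"
    unfolding W_def using sqintD(2)[OF sqS] Hi by auto
  have bound: "(cmod (S n x))\<^sup>2 \<le> W x" if x: "summable (\<lambda>n. h n x)" for n x
  proof -
    have "(\<Sum>i<n. cmod (D i x))\<^sup>2 = (\<Sum>i<n. sqrt ((1 / 2) ^ i) * sqrt (h i x))\<^sup>2"
      by (simp add: h_def real_sqrt_mult[symmetric] flip: power_mult_distrib mult.assoc)
    also have "\<dots> \<le> (\<Sum>i<n. (sqrt ((1 / 2) ^ i))\<^sup>2) * (\<Sum>i<n. (sqrt (h i x))\<^sup>2)"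
      by (rule Cauchy_Schwarz_ineq_sum)
    also have "\<dots> = (\<Sum>i<n. (1 / 2) ^ i) * (\<Sum>i<n. h i x)" using hnn by simp
    also have "\<dots> \<le> 2 * H x"
    proof (rule mult_mono)
      show "(\<Sum>i<n. (1 / 2) ^ i) \<le> (2::real)" by (simp add: sum_gp_strict)
      show "(\<Sum>i<n. h i x) \<le> H x"
        unfolding H_def using x hnn by (intro sum_le_suminf) auto
    qed (auto intro: sum_nonneg hnn)
    finally have A: "(\<Sum>i<n. cmod (D i x))\<^sup>2 \<le> 2 * H x" .
    have "cmod (S n x) \<le> cmod (S 0 x) + (\<Sum>i<n. cmod (D i x))"
      unfolding S_sum[of n] by (rule order.trans[OF norm_triangle_ineq]) (auto intro: norm_sum)
    then have "(cmod (S n x))\<^sup>2 \<le> (cmod (S 0 x) + (\<Sum>i<n. cmod (D i x)))\<^sup>2"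
      by (rule power_mono) simp
    also have "\<dots> \<le> 2 * (cmod (S 0 x))\<^sup>2 + 2 * (\<Sum>i<n. cmod (D i x))\<^sup>2"
      using sum_squares_bound[of "cmod (S 0 x)" "\<Sum>i<n. cmod (D i x)"] by (simp add: power2_sum)
    finally show ?thesis using A by (simp add: W_def)
  qed
  \<comment> \<open>At points of divergence \<open>lim\<close> is an unspecified value, but it
    depends only on the sequence of partial sums, which is itself periodic in \<open>x\<close>;
    hence \<open>g\<close> is periodic everywhere.\<close>
  define g where "g x = lim (\<lambda>n. S n x)" for x
  have conv: "(\<lambda>n. S n x) \<longlonglongrightarrow> g x" if x: "summable (\<lambda>n. h n x)" for x
  proof -
    have "summable (\<lambda>n. D n x)"
    proof (rule summable_comparison_test')
      show "summable (\<lambda>n. (1 / 2) ^ n + h n x)" using x by (intro summable_add) auto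
      fix n
      have "2 * (cmod (D n x) * (1 / 2) ^ n) \<le> (cmod (D n x))\<^sup>2 + ((1 / 2) ^ n)\<^sup>2"
        using sum_squares_bound[of "cmod (D n x)" "(1 / 2) ^ n"] by simp
      then have "2 ^ n * (2 * (cmod (D n x) * (1 / 2) ^ n)) \<le> 2 ^ n * ((cmod (D n x))\<^sup>2 + ((1 / 2) ^ n)\<^sup>2)"
        by (rule mult_left_mono) simp
      then have "2 * cmod (D n x) \<le> (1 / 2) ^ n + h n x"
        by (simp add: h_def power2_eq_square algebra_simps power_one_over)
      moreover have "cmod (D n x) \<le> 2 * cmod (D n x)" by simp
      ultimately show "norm (D n x) \<le> (1 / 2) ^ n + h n x" by linarith
    qed
    then have "(\<lambda>n. S 0 x + (\<Sum>i<n. D i x)) \<longlonglongrightarrow> S 0 x + (\<Sum>i. D i x)"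
      by (intro tendsto_intros summable_LIMSEQ)
    then have "(\<lambda>n. S n x) \<longlonglongrightarrow> S 0 x + (\<Sum>i. D i x)" by (simp flip: S_sum)
    then show ?thesis by (simp add: g_def limI)
  qed
  have gm[measurable]: "g \<in> borel_measurable borel"
    unfolding g_def by (rule borel_measurable_lim_metric) simp
  have per: "g (x + L) = g x" for x
    using L by (simp add: g_def S_def trig_poly_def basis_periodic)
  have sq_lim: "integrable (torus L) (\<lambda>x. (cmod (g x))\<^sup>2) \<and>
     (\<lambda>n. LINT x|torus L. (cmod (S n x))\<^sup>2) \<longlonglongrightarrow> (LINT x|torus L. (cmod (g x))\<^sup>2)"
  proof (intro conjI)
    have lim: "AE x in torus L. (\<lambda>n. (cmod (S n x))\<^sup>2) \<longlonglongrightarrow> (cmod (g x))\<^sup>2"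
      using AEs by eventually_elim (intro tendsto_intros conv)
    have bd: "AE x in torus L. norm ((cmod (S n x))\<^sup>2) \<le> W x" for n
      using AEs by eventually_elim (simp add: bound)
    show "integrable (torus L) (\<lambda>x. (cmod (g x))\<^sup>2)"
      by (rule integrable_dominated_convergence[OF _ _ Wi lim bd]) auto
    show "(\<lambda>n. LINT x|torus L. (cmod (S n x))\<^sup>2) \<longlonglongrightarrow> (LINT x|torus L. (cmod (g x))\<^sup>2)"
      by (rule integral_dominated_convergence[OF _ _ Wi lim bd]) auto
  qed
  have gL: "g \<in> L2_torus L"
    using gm per sq_lim by (simp add: L2_torus_def set_integrable_torus)
  have "(\<lambda>n. sum w (F n)) \<longlonglongrightarrow> infsum w UNIV"
  proof (rule tendsto_sandwich)
    show "\<forall>\<^sub>F n in sequentially. infsum w UNIV - (1 / 4) ^ n \<le> sum w (F n)"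
      using F(5) by (simp add: algebra_simps)
    have "(\<lambda>n. infsum w UNIV - (1 / 4) ^ n) \<longlonglongrightarrow> infsum w UNIV - 0"
      by (intro tendsto_intros LIMSEQ_power_zero) auto
    then show "(\<lambda>n. infsum w UNIV - (1 / 4) ^ n) \<longlonglongrightarrow> infsum w UNIV" by simp
  qed (use F(4) in auto)
  moreover have "(LINT x|torus L. (cmod (S n x))\<^sup>2) = sum w (F n)" for n
    using L F(1) by (simp add: S_def trig_poly_norm w_def)
  ultimately have norm: "(LINT x|torus L. (cmod (g x))\<^sup>2) = infsum w UNIV"
    using sq_lim LIMSEQ_unique by fastforce
  have "fourier L g k = c k" for k
  proof -
    have "(\<lambda>n. fourier L (S n) k) \<longlonglongrightarrow> fourier L g k"
      unfolding fourier_basis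
    proof (rule integral_dominated_convergence)
      interpret finite_measure "torus L" using L by (simp add: finite_measure_torus)
      show "integrable (torus L) (\<lambda>x. (1 + W x) * (1 / sqrt L))"
        using Wi by (intro integrable_mult_left Bochner_Integration.integrable_add) auto
      show "AE x in torus L. (\<lambda>n. S n x * cnj (basis L k x)) \<longlonglongrightarrow> g x * cnj (basis L k x)"
        using AEs by eventually_elim (intro tendsto_intros conv)
      show "AE x in torus L. norm (S n x * cnj (basis L k x)) \<le> (1 + W x) * (1 / sqrt L)" for n
        using AEs
      proof eventually_elim
        case (elim x)
        have "cmod (S n x) \<le> 1 + (cmod (S n x))\<^sup>2"
          using sum_squares_bound[of "cmod (S n x)" 1] norm_ge_zero[of "S n x"] 
          by (smt (verit) mult_cancel_left1 one_power2)
        also have "\<dots> \<le> 1 + W x" using bound[OF elim] by simp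
        finally show ?case
          using L by (simp add: norm_mult norm_basis divide_right_mono)
      qed
    qed auto
    moreover have "\<forall>\<^sub>F n in sequentially. fourier L (S n) k = c k"
      using eventually_ge_at_top[of "nat \<bar>k\<bar>"]
    proof eventually_elim
      case (elim n)
      then have "k \<in> {- int n..int n}" by auto
      then have "k \<in> F n" using F(3)[of n] by blast
      then show ?case using L F(1) by (simp add: S_def fourier_trig_poly)
    qed
    then have "(\<lambda>n. fourier L (S n) k) \<longlonglongrightarrow> c k"
      by (rule tendsto_eventually)
    ultimately show ?thesis by (rule LIMSEQ_unique)
  qed
  with gL norm show ?thesis by (intro that[of g]) (auto simp: w_def[abs_def])
qed

lemma fourier_unique:
  assumes L: "L > 0" and f: "integrable (torus L) f" and g: "integrable (torus L) g"
    and eq: "\<And>k. fourier L f k = fourier L g k"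
  shows "AE x in torus L. f x = g x"
proof -
  have "(LINT x|torus L. (f x - g x) * torus_char L k x) = 0" for k
    using eq[of "- k"] L f g by (simp add: fourier_char left_diff_distrib integrable_mult_char)
  then have "AE x in torus L. f x - g x = 0"
    using f g by (intro char_coeffs_zero_AE L) auto
  then show ?thesis by eventually_elim simp
qed

text \<open>Riesz-Fischer gives a function with the same coefficients and the correct norm, and
  uniqueness identifies it with \<open>f\<close>. Equality in Bessel thus comes without a density
  argument for trigonometric polynomials in \<open>L^2\<close>.\<close>

lemma parseval:
  assumes L: "L > 0" and f: "sqint L f"
  shows "((\<lambda>k. (cmod (fourier L f k))\<^sup>2) has_sum (LINT x|torus L. (cmod (f x))\<^sup>2)) UNIV"
proof -
  have s: "(\<lambda>k. (cmod (fourier L f k))\<^sup>2) summable_on UNIV"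
    using L f by (rule fourier_square_summable)
  obtain g where g: "g \<in> L2_torus L" "\<And>k. fourier L g k = fourier L f k"
    "(LINT x|torus L. (cmod (g x))\<^sup>2) = (\<Sum>\<^sub>\<infinity>k. (cmod (fourier L f k))\<^sup>2)"
    using riesz_fischer[OF L s] by metis
  note [measurable] = sqintD(1)[OF f] sqintD(1)[OF L2_torus_sqint[OF g(1)]]
  have "AE x in torus L. f x = g x"
    using L f g by (intro fourier_unique) (auto intro: sqint_integrable L2_torus_sqint)
  then have "(LINT x|torus L. (cmod (f x))\<^sup>2) = (LINT x|torus L. (cmod (g x))\<^sup>2)"
    by (intro integral_cong_AE) auto
  then show ?thesis using s g(3) by simp
qed

text \<open>The factors \<open>1\<close>, \<open>-1\<close>, \<open>\<i>\<close>,
  \<open>-\<i>\<close> are written out so that all four squares are instances of one pattern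
  \<open>z + u * w\<close>, to which Parseval applies.\<close>

lemma polarization:
  "z * cnj w = (of_real ((cmod (z + 1 * w))\<^sup>2) + (-1) * of_real ((cmod (z + (-1) * w))\<^sup>2) +
     \<i> * of_real ((cmod (z + \<i> * w))\<^sup>2) + (-\<i>) * of_real ((cmod (z + (-\<i>) * w))\<^sup>2)) / 4"
  unfolding cmod_power2 by (simp add: complex_eq_iff power2_eq_square algebra_simps)

lemma parseval_inner:
  assumes L: "L > 0" and f: "sqint L f" and g: "sqint L g"
  shows "((\<lambda>k. fourier L f k * cnj (fourier L g k)) has_sum (LINT x|torus L. f x * cnj (g x))) UNIV"
proof -
  have sq: "sqint L (\<lambda>x. f x + u * g x)" for u
    using f g by (intro sqint_add sqint_cmult)
  have h: "((\<lambda>k. complex_of_real ((cmod (fourier L f k + u * fourier L g k))\<^sup>2)) has_sum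
      of_real (LINT x|torus L. (cmod (f x + u * g x))\<^sup>2)) UNIV" for u
    using parseval[OF L sq[of u]] L f g
    by (subst has_sum_of_real_iff) (simp add: fourier_add sqint_cmult fourier_cmult)
  have i: "integrable (torus L) (\<lambda>x. complex_of_real ((cmod (f x + u * g x))\<^sup>2))" for u
    using sqintD(2)[OF sq] by (rule integrable_of_real)
  have "(LINT x|torus L. f x * cnj (g x)) =
      (of_real (LINT x|torus L. (cmod (f x + 1 * g x))\<^sup>2) + (-1) * of_real (LINT x|torus L. (cmod (f x + (-1) * g x))\<^sup>2)
      + \<i> * of_real (LINT x|torus L. (cmod (f x + \<i> * g x))\<^sup>2)
      + (-\<i>) * of_real (LINT x|torus L. (cmod (f x + (-\<i>) * g x))\<^sup>2)) / 4"
    unfolding polarization[of "f _"] integral_complex_of_real[symmetric]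
    using i[of 1] i[of "-1"] i[of \<i>] i[of "-\<i>"] by simp
  moreover have "((\<lambda>k. fourier L f k * cnj (fourier L g k)) has_sum
      (of_real (LINT x|torus L. (cmod (f x + 1 * g x))\<^sup>2) + (-1) * of_real (LINT x|torus L. (cmod (f x + (-1) * g x))\<^sup>2)
      + \<i> * of_real (LINT x|torus L. (cmod (f x + \<i> * g x))\<^sup>2)
      + (-\<i>) * of_real (LINT x|torus L. (cmod (f x + (-\<i>) * g x))\<^sup>2)) / 4) UNIV"
    unfolding polarization[of "fourier L f _"]
    by (intro has_sum_divide_const has_sum_add has_sum_cmult_right h)
  ultimately show ?thesis by (simp only:)
qed

section \<open>Fourth powers and autocorrelation of the coefficients\<close>

definition corr :: "(int \<Rightarrow> complex) \<Rightarrow> int \<Rightarrow> complex" where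
  "corr c m = (\<Sum>\<^sub>\<infinity>k. c (k + m) * cnj (c k))"

text \<open>Multiplication by a character shifts the coefficients, so this is Parseval for
  \<open>g\<close> against a modulated copy of itself.\<close>

lemma fourier_norm_square:
  assumes L: "L > 0" and g: "sqint L g"
  shows "fourier L (\<lambda>x. of_real ((cmod (g x))\<^sup>2)) m = corr (fourier L g) m / of_real (sqrt L)"
proof -
  have "fourier L (\<lambda>x. g x * torus_char L (- m) x) k = fourier L g (k + m)" for k
    using L char_add[of L "- k" "- m"] by (simp add: fourier_char mult_ac)
  then have "((\<lambda>k. fourier L g (k + m) * cnj (fourier L g k)) has_sum
      (LINT x|torus L. g x * torus_char L (- m) x * cnj (g x))) UNIV"
    using parseval_inner[OF L sqint_char[OF g, of "- m"] g] by simp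
  then have "corr (fourier L g) m = (LINT x|torus L. g x * torus_char L (- m) x * cnj (g x))"
    unfolding corr_def by (rule infsumI)
  also have "\<dots> = (LINT x|torus L. of_real ((cmod (g x))\<^sup>2) * torus_char L (- m) x)"
    unfolding complex_norm_square by (simp add: mult_ac)
  finally show ?thesis using L by (simp add: fourier_char)
qed

text \<open>Both sides are zero, by the conventions for undefined integrals and sums, when \<open>g\<close> is not in \<open>L\<^sup>4\<close>.\<close>

lemma integral_norm_power4:
  assumes L: "L > 0" and g: "sqint L g"
  shows "(LINT x|torus L. (cmod (g x)) ^ 4) = (\<Sum>\<^sub>\<infinity>m. (cmod (corr (fourier L g) m))\<^sup>2) / L"
proof -
  note [measurable] = sqintD(1)[OF g]
  have i: "integrable (torus L) (\<lambda>x. complex_of_real ((cmod (g x))\<^sup>2))"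
    using sqintD(2)[OF g] by (rule integrable_of_real)
  have n: "(cmod (corr (fourier L g) m / of_real (sqrt L)))\<^sup>2 = (cmod (corr (fourier L g) m))\<^sup>2 / L" for m
    using L by (simp add: norm_divide power_divide)
  have p4: "(cmod (of_real ((cmod (g x))\<^sup>2)))\<^sup>2 = cmod (g x) ^ 4" for x
    unfolding norm_of_real by (simp flip: power_mult)
  show ?thesis
  proof (cases "(\<lambda>m. (cmod (corr (fourier L g) m))\<^sup>2) summable_on UNIV")
    case True
    then have "(\<lambda>m. (cmod (corr (fourier L g) m / of_real (sqrt L)))\<^sup>2) summable_on UNIV"
      unfolding n unfolding divide_inverse by (rule summable_on_cmult_left)
    from riesz_fischer[OF L this] obtain h where h: "h \<in> L2_torus L"
      "\<And>k. fourier L h k = corr (fourier L g) k / of_real (sqrt L)"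
      "(LINT x|torus L. (cmod (h x))\<^sup>2) = (\<Sum>\<^sub>\<infinity>m. (cmod (corr (fourier L g) m / of_real (sqrt L)))\<^sup>2)"
      by metis
    note [measurable] = sqintD(1)[OF L2_torus_sqint[OF h(1)]]
    \<comment> \<open>Here uniqueness is applied to \<open>|g|^2\<close>, which is known only to be
      integrable; equality with the square-integrable \<open>h\<close> is what puts \<open>g\<close>
      into \<open>L^4\<close>.\<close>
    have "AE x in torus L. h x = of_real ((cmod (g x))\<^sup>2)"
      using L g h i by (intro fourier_unique) (auto simp: fourier_norm_square simp del: of_real_power intro: sqint_integrable L2_torus_sqint)
    then have "AE x in torus L. (cmod (g x)) ^ 4 = (cmod (h x))\<^sup>2"
      by eventually_elim (simp only: p4)
    then have "(LINT x|torus L. (cmod (g x)) ^ 4) = (LINT x|torus L. (cmod (h x))\<^sup>2)"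
      by (intro integral_cong_AE) auto
    also have "\<dots> = (\<Sum>\<^sub>\<infinity>m. (cmod (corr (fourier L g) m))\<^sup>2) / L"
      unfolding h(3) n unfolding divide_inverse by (simp add: infsum_cmult_left')
    finally show ?thesis .
  next
    case False
    have "\<not> integrable (torus L) (\<lambda>x. (cmod (g x)) ^ 4)"
    proof
      assume "integrable (torus L) (\<lambda>x. (cmod (g x)) ^ 4)"
      then have "sqint L (\<lambda>x. of_real ((cmod (g x))\<^sup>2))"
        unfolding sqint_def p4 using borel_measurable_integrable[OF i] by blast
      from fourier_square_summable[OF L this]
      have "(\<lambda>m. (cmod (corr (fourier L g) m))\<^sup>2 * inverse L) summable_on UNIV"
        unfolding fourier_norm_square[OF L g] n unfolding divide_inverse .
      then show False using False L by (simp add: summable_on_cmult_left')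
    qed
    then show ?thesis
      using False by (simp add: not_integrable_integral_eq infsum_not_exists)
  qed
qed

section \<open>The quadrilinear form on sequences\<close>

lemma has_sum_times:
  fixes f :: "'a \<Rightarrow> 'c :: {real_normed_field, banach}" and g :: "'b \<Rightarrow> 'c"
  assumes f: "(f has_sum A) UNIV" and g: "(g has_sum B) UNIV"
    and fa: "(\<lambda>x. norm (f x)) summable_on UNIV" and ga: "(\<lambda>x. norm (g x)) summable_on UNIV"
  shows "((\<lambda>(x, y). f x * g y) has_sum A * B) UNIV" "(\<lambda>(x, y). norm (f x * g y)) summable_on UNIV"
proof -
  have "(\<lambda>(x, y). norm (f x) * norm (g y)) summable_on UNIV \<times> UNIV"
  proof (rule summable_on_SigmaI)
    show "((\<lambda>y. case (x, y) of (x, y) \<Rightarrow> norm (f x) * norm (g y)) has_sum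
        norm (f x) * infsum (\<lambda>y. norm (g y)) UNIV) UNIV" for x
      using ga by (auto intro: has_sum_cmult_right)
  qed (auto intro: summable_on_cmult_left fa)
  then show s: "(\<lambda>(x, y). norm (f x * g y)) summable_on UNIV"
    by (simp add: norm_mult)
  then have "(\<lambda>p. norm ((\<lambda>(x, y). f x * g y) p)) summable_on UNIV"
    by (simp add: case_prod_unfold)
  then have "(\<lambda>(x, y). f x * g y) summable_on UNIV"
    by (rule Infinite_Sum.abs_summable_summable)
  then have "((\<lambda>(x, y). f x * g y) has_sum A * B) (UNIV \<times> UNIV)"
    by (intro has_sum_SigmaI[where g = "\<lambda>x. f x * B"])
      (auto intro: has_sum_cmult_right has_sum_cmult_left f g)
  then show "((\<lambda>(x, y). f x * g y) has_sum A * B) UNIV" by simp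
qed

section \<open>Decay of the time integral\<close>

definition recip :: "int \<Rightarrow> real" where
  "recip n = 1 / \<bar>of_int n\<bar>"

lemma recip_nonneg [simp]: "recip n \<ge> 0"
  by (simp add: recip_def)

text \<open>Division by zero gives 0 here, so the resonant index drops out of every sum weighted by
  \<open>recip\<close>; resonances are counted separately by \<open>of_bool\<close>.\<close>

lemma recip_0 [simp]: "recip 0 = 0"
  by (simp add: recip_def)

lemma recip_minus [simp]: "recip (- n) = recip n"
  by (simp add: recip_def)

lemma recip_square_summable: "(\<lambda>n. (recip n)\<^sup>2) summable_on UNIV"
proof -
  have "(\<lambda>n. (recip (int n))\<^sup>2) summable_on UNIV"
    using inverse_power_summable[of 2, where 'a = real]
    by (subst summable_on_UNIV_nonneg_real_iff) (simp_all add: recip_def divide_inverse power_inverse)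
  then have p: "(\<lambda>n. (recip n)\<^sup>2) summable_on range int"
    by (subst summable_on_reindex) (auto simp: o_def)
  moreover have "(\<lambda>n. (recip n)\<^sup>2) summable_on uminus ` range int"
    using p by (subst summable_on_reindex) (auto simp: o_def)
  moreover have "UNIV = range int \<union> uminus ` range int"
    by (auto simp: image_iff) (metis int_cases2)
  ultimately show ?thesis by (metis summable_on_union)
qed

text \<open>The time average of the phase left over from four evolved coefficients;
  \<open>torus 1\<close> serves merely as the time interval \<open>[0, 1]\<close>.\<close>

definition osc :: "real \<Rightarrow> int \<Rightarrow> complex" where
  "osc L n = (LINT r|torus 1. cis (- (8 * pi\<^sup>2 / L\<^sup>2) * of_int n * r))"

lemma osc_minus: "osc L (- n) = cnj (osc L n)"
  unfolding osc_def Bochner_Integration.integral_cnj[symmetric] cis_cnj by simp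

lemma norm_osc_le_1: "cmod (osc L n) \<le> 1"
proof -
  have "cmod (osc L n) \<le> (LINT r|torus 1. cmod (cis (- (8 * pi\<^sup>2 / L\<^sup>2) * of_int n * r)))"
    unfolding osc_def by (rule integral_norm_bound)
  then show ?thesis by (simp add: measure_torus)
qed

lemma norm_osc_le_recip:
  assumes L: "L > 0" and n: "n \<noteq> 0"
  shows "cmod (osc L n) \<le> L\<^sup>2 * recip n"
proof -
  define a where "a = - (8 * pi\<^sup>2 / L\<^sup>2) * of_int n"
  have a: "a \<noteq> 0" using L n by (simp add: a_def)
  have "cmod (osc L n) = cmod (cis a - 1) / \<bar>a\<bar>"
    unfolding osc_def a_def[symmetric] using integral_cis[of 1 a] a by (simp add: norm_divide norm_mult)
  also have "\<dots> \<le> 2 / \<bar>a\<bar>"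
    using norm_triangle_ineq4[of "cis a" 1] by (intro divide_right_mono) auto
  also have "\<dots> = L\<^sup>2 * recip n * (1 / (4 * pi\<^sup>2))"
    using L n by (simp add: a_def recip_def abs_mult field_simps)
  also have "\<dots> \<le> L\<^sup>2 * recip n * 1"
  proof (intro mult_left_mono)
    have "1 \<le> pi\<^sup>2" using pi_gt3 by (intro one_le_power) linarith
    then show "1 / (4 * pi\<^sup>2) \<le> 1" by simp
  qed auto
  finally show ?thesis by simp
qed

lemma norm_osc_mult:
  assumes L: "L > 0"
  shows "cmod (osc L (m * i)) \<le> of_bool (m = 0) + of_bool (i = 0) + L\<^sup>2 * (recip m * recip i)"
proof (cases "m = 0 \<or> i = 0")
  case True
  have "0 \<le> L\<^sup>2 * (recip m * recip i)" by simp
  then show ?thesis using norm_osc_le_1[of L "m * i"] True by auto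
next
  case False
  then show ?thesis
    using norm_osc_le_recip[OF L, of "m * i"] by (simp add: recip_def abs_mult)
qed

text \<open>A summable majorant in each variable separately, via AM-GM on \<open>recip m * recip i\<close>.\<close>

definition osc_weight :: "real \<Rightarrow> int \<Rightarrow> real" where
  "osc_weight L n = of_bool (n = 0) + L\<^sup>2 * (recip n)\<^sup>2"

lemma osc_weight_nonneg: "osc_weight L n \<ge> 0"
  by (simp add: osc_weight_def)

lemma norm_osc_mult_le_weight:
  assumes "L > 0"
  shows "cmod (osc L (m * i)) \<le> osc_weight L m + osc_weight L i"
proof -
  have "recip m * recip i \<le> 2 * recip m * recip i" by simp
  also have "\<dots> \<le> (recip m)\<^sup>2 + (recip i)\<^sup>2" by (rule sum_squares_bound)
  finally have "L\<^sup>2 * (recip m * recip i) \<le> L\<^sup>2 * ((recip m)\<^sup>2 + (recip i)\<^sup>2)"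
    by (rule mult_left_mono) simp
  then show ?thesis
    using norm_osc_mult[OF assms, of m i] by (simp add: osc_weight_def algebra_simps)
qed

lemma osc_weight_summable: "osc_weight L summable_on UNIV"
proof -
  have "(\<lambda>n::int. of_bool (n = 0) :: real) summable_on UNIV"
    by (rule finite_nonzero_values_imp_summable_on) auto
  then show ?thesis
    unfolding osc_weight_def[abs_def]
    by (intro summable_on_add summable_on_cmult_right recip_square_summable)
qed

section \<open>The quadrilinear form: absolute convergence and symmetries\<close>

definition ell2 :: "(int \<Rightarrow> complex) \<Rightarrow> bool" where
  "ell2 u \<longleftrightarrow> (\<lambda>k. (cmod (u k))\<^sup>2) summable_on UNIV"

text \<open>The frequencies \<open>k + m\<close>, \<open>k\<close>, \<open>l + m\<close>,
  \<open>l\<close> have alternating sum zero automatically, and the resonance function factors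
  through the two differences \<open>m\<close> and \<open>k - l\<close>. The conjugated slots are
  the second and third, unlike in \<open>Q_form\<close>; the two orders are compared only when all
  arguments agree.\<close>

definition qterm :: "real \<Rightarrow> (int \<Rightarrow> complex) \<Rightarrow> (int \<Rightarrow> complex) \<Rightarrow> (int \<Rightarrow> complex) \<Rightarrow> (int \<Rightarrow> complex)
    \<Rightarrow> int \<times> int \<times> int \<Rightarrow> complex" where
  "qterm L u1 u2 u3 u4 =
    (\<lambda>(m, k, l). u1 (k + m) * cnj (u2 k) * cnj (u3 (l + m)) * u4 l * osc L (m * (k - l)))"

definition quad :: "real \<Rightarrow> (int \<Rightarrow> complex) \<Rightarrow> (int \<Rightarrow> complex) \<Rightarrow> (int \<Rightarrow> complex) \<Rightarrow> (int \<Rightarrow> complex)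
    \<Rightarrow> complex" where
  "quad L u1 u2 u3 u4 = infsum (qterm L u1 u2 u3 u4) UNIV"

lemma has_sum_products:
  fixes \<beta> w :: "int \<Rightarrow> real"
  assumes \<beta>: "\<beta> summable_on UNIV" "\<And>k. \<beta> k \<ge> 0" and w: "w summable_on UNIV" "\<And>k. w k \<ge> 0"
  shows "((\<lambda>(p, q, n). \<beta> p * (\<beta> q * w n)) has_sum (infsum \<beta> UNIV * (infsum \<beta> UNIV * infsum w UNIV))) UNIV"
proof -
  have 1: "((\<lambda>(q, n). \<beta> q * w n) has_sum (infsum \<beta> UNIV * infsum w UNIV)) UNIV"
    "(\<lambda>(q, n). norm (\<beta> q * w n)) summable_on UNIV"
    using has_sum_times[of \<beta> "infsum \<beta> UNIV" w "infsum w UNIV"] \<beta> w by simp_all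
  have "((\<lambda>(p, y). \<beta> p * (\<lambda>(q, n). \<beta> q * w n) y) has_sum
      (infsum \<beta> UNIV * (infsum \<beta> UNIV * infsum w UNIV))) UNIV"
    by (rule has_sum_times(1)) (use \<beta> 1 in \<open>simp_all add: case_prod_unfold\<close>)
  then show ?thesis by (simp add: case_prod_unfold)
qed

text \<open>AM-GM on the pairs \<open>(k + m, l)\<close> and \<open>(k, l + m)\<close>, combined
  with the two weights, gives four products. In each, the two frequencies and the argument of the
  weight are independent integer coordinates, so its sum is \<open>X * X * W\<close>; the
  coefficients 1/2 add up to the factor 2.\<close>

lemma qterm_majorant:
  assumes L: "L > 0" and b: "(\<lambda>k. (b k)\<^sup>2) summable_on UNIV" "\<And>k. b k \<ge> 0"
  defines "X \<equiv> (\<Sum>\<^sub>\<infinity>k. (b k)\<^sup>2)"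
  obtains T where "(T has_sum (2 * infsum (osc_weight L) UNIV * X\<^sup>2)) UNIV"
    "\<And>m k l. b (k + m) * b k * b (l + m) * b l * cmod (osc L (m * (k - l))) \<le> T (m, k, l)"
proof -
  define \<beta> where "\<beta> k = (b k)\<^sup>2" for k
  define w where "w = osc_weight L"
  define W where "W = infsum w UNIV"
  have H: "((\<lambda>(p, q, n). \<beta> p * (\<beta> q * w n)) has_sum X * (X * W)) UNIV"
    unfolding X_def W_def \<beta>_def[symmetric]
    using has_sum_products[of \<beta> w] b(1) osc_weight_summable[of L] osc_weight_nonneg[of L]
    by (auto simp: \<beta>_def[abs_def] w_def)
  have 1: "((\<lambda>(m, k, l). \<beta> (k + m) * (\<beta> l * w m)) has_sum X * (X * W)) UNIV"
    by (rule has_sum_reindex_bij_witness[where i = "\<lambda>(p, q, n). (n, p - n, q)" and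
          j = "\<lambda>(m, k, l). (k + m, l, m)", THEN iffD2, OF _ _ _ _ _ refl H]) auto
  have 2: "((\<lambda>(m, k, l). \<beta> (k + m) * (\<beta> l * w (k - l))) has_sum X * (X * W)) UNIV"
    by (rule has_sum_reindex_bij_witness[where i = "\<lambda>(p, q, n). (p - n - q, n + q, q)" and
          j = "\<lambda>(m, k, l). (k + m, l, k - l)", THEN iffD2, OF _ _ _ _ _ refl H]) auto
  have 3: "((\<lambda>(m, k, l). \<beta> k * (\<beta> (l + m) * w m)) has_sum X * (X * W)) UNIV"
    by (rule has_sum_reindex_bij_witness[where i = "\<lambda>(p, q, n). (n, p, q - n)" and
          j = "\<lambda>(m, k, l). (k, l + m, m)", THEN iffD2, OF _ _ _ _ _ refl H]) auto
  have 4: "((\<lambda>(m, k, l). \<beta> k * (\<beta> (l + m) * w (k - l))) has_sum X * (X * W)) UNIV"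
    by (rule has_sum_reindex_bij_witness[where i = "\<lambda>(p, q, n). (q - p + n, p, p - n)" and
          j = "\<lambda>(m, k, l). (k, l + m, k - l)", THEN iffD2, OF _ _ _ _ _ refl H]) auto
  define T where "T x = (case x of (m, k, l) \<Rightarrow> \<beta> (k + m) * (\<beta> l * w m)) / 2 +
     (case x of (m, k, l) \<Rightarrow> \<beta> (k + m) * (\<beta> l * w (k - l))) / 2 +
     (case x of (m, k, l) \<Rightarrow> \<beta> k * (\<beta> (l + m) * w m)) / 2 +
     (case x of (m, k, l) \<Rightarrow> \<beta> k * (\<beta> (l + m) * w (k - l))) / 2" for x
  have "(T has_sum (X * (X * W) / 2 + X * (X * W) / 2 + X * (X * W) / 2 + X * (X * W) / 2)) UNIV"
    unfolding T_def[abs_def] by (intro has_sum_add has_sum_divide_const 1 2 3 4)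
  then have "(T has_sum (2 * infsum (osc_weight L) UNIV * X\<^sup>2)) UNIV"
    by (simp add: W_def w_def power2_eq_square mult_ac)
  moreover have "b (k + m) * b k * b (l + m) * b l * cmod (osc L (m * (k - l))) \<le> T (m, k, l)" for m k l
  proof -
    have "b (k + m) * b k * b (l + m) * b l = (b (k + m) * b l) * (b k * b (l + m))" by simp
    also have "\<dots> \<le> ((b (k + m) * b l)\<^sup>2 + (b k * b (l + m))\<^sup>2) / 2"
      using sum_squares_bound[of "b (k + m) * b l" "b k * b (l + m)"] by simp
    also have "\<dots> = (\<beta> (k + m) * \<beta> l + \<beta> k * \<beta> (l + m)) / 2"
      by (simp add: \<beta>_def power_mult_distrib)
    finally have "b (k + m) * b k * b (l + m) * b l * cmod (osc L (m * (k - l))) \<le>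
        (\<beta> (k + m) * \<beta> l + \<beta> k * \<beta> (l + m)) / 2 * (w m + w (k - l))"
      using norm_osc_mult_le_weight[OF L, of m "k - l"]
      by (intro mult_mono) (auto simp: w_def \<beta>_def osc_weight_nonneg)
    also have "\<dots> = T (m, k, l)" by (simp add: T_def field_simps)
    finally show ?thesis .
  qed
  ultimately show ?thesis using that by blast
qed

lemma ell2_add:
  assumes "ell2 u" "ell2 v" shows "ell2 (\<lambda>k. u k + v k)"
proof -
  have "(\<lambda>k. norm ((cmod (u k + v k))\<^sup>2)) summable_on UNIV"
  proof (rule Infinite_Sum.abs_summable_on_comparison_test')
    show "(\<lambda>k. 2 * (cmod (u k))\<^sup>2 + 2 * (cmod (v k))\<^sup>2) summable_on UNIV"
      using assms by (auto simp: ell2_def intro!: summable_on_add summable_on_cmult_right)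
    fix k
    have "(cmod (u k + v k))\<^sup>2 \<le> (cmod (u k) + cmod (v k))\<^sup>2"
      by (intro power_mono norm_triangle_ineq) auto
    then show "norm ((cmod (u k + v k))\<^sup>2) \<le> 2 * (cmod (u k))\<^sup>2 + 2 * (cmod (v k))\<^sup>2"
      using sum_squares_bound[of "cmod (u k)" "cmod (v k)"] by (simp add: power2_sum)
  qed
  then show ?thesis by (simp add: ell2_def)
qed

lemma ell2_cmult: "ell2 u \<Longrightarrow> ell2 (\<lambda>k. c * u k)"
  by (auto simp: ell2_def norm_mult power_mult_distrib intro: summable_on_cmult_right)

lemma ell2_norm: "ell2 (\<lambda>k. of_real (cmod (u k))) \<longleftrightarrow> ell2 u"
  by (simp add: ell2_def)

lemma qterm_summable:
  assumes L: "L > 0" and u: "ell2 u1" "ell2 u2" "ell2 u3" "ell2 u4"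
  shows "(\<lambda>x. norm (qterm L u1 u2 u3 u4 x)) summable_on UNIV" "qterm L u1 u2 u3 u4 summable_on UNIV"
proof -
  define b where "b k = cmod (u1 k) + cmod (u2 k) + cmod (u3 k) + cmod (u4 k)" for k
  have bn: "b k \<ge> 0" for k by (simp add: b_def)
  have "ell2 (\<lambda>k. of_real (b k))"
    unfolding b_def of_real_add by (intro ell2_add) (simp_all add: ell2_norm u)
  then have bs: "(\<lambda>k. (b k)\<^sup>2) summable_on UNIV"
    by (simp add: ell2_def)
  obtain T where T: "(T has_sum (2 * infsum (osc_weight L) UNIV * (\<Sum>\<^sub>\<infinity>k. (b k)\<^sup>2)\<^sup>2)) UNIV"
    "\<And>m k l. b (k + m) * b k * b (l + m) * b l * cmod (osc L (m * (k - l))) \<le> T (m, k, l)"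
    using qterm_majorant[OF L bs bn] by metis
  show s: "(\<lambda>x. norm (qterm L u1 u2 u3 u4 x)) summable_on UNIV"
  proof (rule Infinite_Sum.abs_summable_on_comparison_test')
    show "T summable_on UNIV" using T(1) by (rule has_sum_imp_summable)
    fix x :: "int \<times> int \<times> int"
    obtain m k l where x: "x = (m, k, l)" by (cases x) auto
    have "norm (qterm L u1 u2 u3 u4 x) =
        cmod (u1 (k + m)) * cmod (u2 k) * cmod (u3 (l + m)) * cmod (u4 l) * cmod (osc L (m * (k - l)))"
      by (simp add: qterm_def x norm_mult)
    also have "\<dots> \<le> b (k + m) * b k * b (l + m) * b l * cmod (osc L (m * (k - l)))"
      by (intro mult_mono mult_nonneg_nonneg bn) (auto simp: b_def)
    finally show "norm (qterm L u1 u2 u3 u4 x) \<le> T x" using T(2)[of k m l] x by simp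
  qed
  then show "qterm L u1 u2 u3 u4 summable_on UNIV" by (rule Infinite_Sum.abs_summable_summable)
qed

lemma norm_quad_le:
  assumes L: "L > 0" and u: "ell2 u"
  shows "cmod (quad L u u u u) \<le> 2 * infsum (osc_weight L) UNIV * (\<Sum>\<^sub>\<infinity>k. (cmod (u k))\<^sup>2)\<^sup>2"
proof -
  obtain T where T: "(T has_sum (2 * infsum (osc_weight L) UNIV * (\<Sum>\<^sub>\<infinity>k. (cmod (u k))\<^sup>2)\<^sup>2)) UNIV"
    "\<And>m k l. cmod (u (k + m)) * cmod (u k) * cmod (u (l + m)) * cmod (u l) * cmod (osc L (m * (k - l))) \<le> T (m, k, l)"
    using qterm_majorant[OF L, of "\<lambda>k. cmod (u k)"] u unfolding ell2_def by (metis norm_ge_zero)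
  show ?thesis
    unfolding quad_def
  proof (rule norm_infsum_le)
    show "(qterm L u u u u has_sum infsum (qterm L u u u u) UNIV) UNIV"
      using qterm_summable(2)[OF L u u u u] by simp
    show "(T has_sum (2 * infsum (osc_weight L) UNIV * (\<Sum>\<^sub>\<infinity>k. (cmod (u k))\<^sup>2)\<^sup>2)) UNIV" by fact
    fix x show "norm (qterm L u u u u x) \<le> T x"
      using T(2) by (cases x) (simp add: qterm_def norm_mult)
  qed
qed

lemma quad_add:
  assumes L: "L > 0" and u: "ell2 u1" "ell2 u2" "ell2 u3" "ell2 u4" and v: "ell2 v"
  shows "quad L (\<lambda>k. u1 k + v k) u2 u3 u4 = quad L u1 u2 u3 u4 + quad L v u2 u3 u4"
    "quad L u1 (\<lambda>k. u2 k + v k) u3 u4 = quad L u1 u2 u3 u4 + quad L u1 v u3 u4"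
    "quad L u1 u2 (\<lambda>k. u3 k + v k) u4 = quad L u1 u2 u3 u4 + quad L u1 u2 v u4"
    "quad L u1 u2 u3 (\<lambda>k. u4 k + v k) = quad L u1 u2 u3 u4 + quad L u1 u2 u3 v"
  unfolding quad_def
  by (subst infsum_add[symmetric]; (intro qterm_summable assms infsum_cong)?;
      simp add: qterm_def case_prod_unfold algebra_simps)+

lemma quad_cmult:
  "quad L (\<lambda>k. c * u1 k) u2 u3 u4 = c * quad L u1 u2 u3 u4"
  "quad L u1 (\<lambda>k. c * u2 k) u3 u4 = cnj c * quad L u1 u2 u3 u4"
  "quad L u1 u2 (\<lambda>k. c * u3 k) u4 = cnj c * quad L u1 u2 u3 u4"
  "quad L u1 u2 u3 (\<lambda>k. c * u4 k) = c * quad L u1 u2 u3 u4"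
  unfolding quad_def
  by (subst infsum_cmult_right'[symmetric]; intro infsum_cong; simp add: qterm_def case_prod_unfold)+

text \<open>This symmetry and \<open>quad_cnj\<close> reduce the first variations in the four slots
  to a single one and its conjugate.\<close>

lemma quad_swap: "quad L u3 u4 u1 u2 = cnj (quad L u1 u2 u3 u4)"
  unfolding quad_def infsum_cnj[symmetric]
proof (rule infsum_reindex_bij_witness[where j = "\<lambda>(m, k, l). (m, l, k)" and i = "\<lambda>(m, k, l). (m, l, k)"])
  fix x :: "int \<times> int \<times> int"
  obtain m k l where x: "x = (m, k, l)" by (cases x) auto
  have "osc L (m * (l - k)) = cnj (osc L (m * (k - l)))"
    using osc_minus[of L "m * (k - l)"] by (simp add: algebra_simps)
  then show "cnj (qterm L u1 u2 u3 u4 (case x of (m, k, l) \<Rightarrow> (m, l, k))) = qterm L u3 u4 u1 u2 x"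
    by (simp add: x qterm_def)
qed auto

lemma quad_cnj: "quad L u2 u1 u4 u3 = cnj (quad L u1 u2 u3 u4)"
  unfolding quad_def infsum_cnj[symmetric]
proof (rule infsum_reindex_bij_witness[where j = "\<lambda>(m, k, l). (- m, k + m, l + m)" and i = "\<lambda>(m, k, l). (- m, k + m, l + m)"])
  fix x :: "int \<times> int \<times> int"
  obtain m k l where x: "x = (m, k, l)" by (cases x) auto
  have "osc L (- (m * (k - l))) = cnj (osc L (m * (k - l)))"
    by (rule osc_minus)
  then show "cnj (qterm L u1 u2 u3 u4 (case x of (m, k, l) \<Rightarrow> (- m, k + m, l + m))) = qterm L u2 u1 u4 u3 x"
    by (simp add: x qterm_def)
qed auto

section \<open>The form in Fourier variables\<close>

text \<open>Holds for divergent series too, since both conventions then give 0. This makes the sum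
  measurable at every point without first removing a null set.\<close>

lemma infsum_eq_enn2real_suminf:
  fixes g :: "nat \<Rightarrow> real"
  assumes "\<And>n. g n \<ge> 0"
  shows "infsum g UNIV = enn2real (\<Sum>n. ennreal (g n))"
proof (cases "summable g")
  case True
  then have "g summable_on UNIV" using assms by (simp add: summable_on_UNIV_nonneg_real_iff)
  then have "infsum g UNIV = (\<Sum>n. g n)"
    by (intro sums_unique has_sum_imp_sums has_sum_infsum)
  then show ?thesis
    using assms True by (simp add: suminf_ennreal2 suminf_nonneg)
next
  case False
  then have "(\<Sum>n. ennreal (g n)) = top"
    using assms summable_suminf_not_top by blast
  moreover have "infsum g UNIV = 0"
    using False assms by (intro infsum_not_exists) (simp add: summable_on_UNIV_nonneg_real_iff)
  ultimately show ?thesis by simp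
qed

text \<open>Tonelli for sums that may diverge at some points and are 0 there by convention:
  summability of the integrals confines divergence to a null set.\<close>

lemma integral_infsum_nonneg:
  fixes f :: "'i::countable \<Rightarrow> 'a \<Rightarrow> real"
  assumes inf: "infinite (UNIV :: 'i set)" and i: "\<And>j. integrable M (f j)"
    and nn: "\<And>j x. f j x \<ge> 0" and s: "(\<lambda>j. LINT x|M. f j x) summable_on UNIV"
  shows "(LINT x|M. (\<Sum>\<^sub>\<infinity>j. f j x)) = (\<Sum>\<^sub>\<infinity>j. LINT x|M. f j x)"
proof -
  note [measurable] = borel_measurable_integrable[OF i]
  define e where "e = from_nat_into (UNIV :: 'i set)"
  have e: "bij_betw e UNIV UNIV"
    unfolding e_def using inf by (intro bij_betw_from_nat_into) auto
  have re: "infsum g UNIV = infsum (\<lambda>n. g (e n)) UNIV" for g :: "'i \<Rightarrow> real"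
    by (rule infsum_reindex_bij_betw[OF e, symmetric])
  have "(\<lambda>n. LINT x|M. f (e n) x) summable_on UNIV"
    using s summable_on_reindex_bij_betw[OF e, of "\<lambda>j. LINT x|M. f j x"] by simp
  then have se: "summable (\<lambda>n. LINT x|M. f (e n) x)"
    by (rule summable_on_imp_summable)
  have eq: "(\<Sum>\<^sub>\<infinity>j. f j x) = enn2real (\<Sum>n. ennreal (f (e n) x))" for x
    unfolding re[of "\<lambda>j. f j x"] by (rule infsum_eq_enn2real_suminf) (rule nn)
  have "AE x in M. summable (\<lambda>n. f (e n) x)"
    by (rule AE_summable_of_integrals) (use i nn se in auto)
  then have ae: "AE x in M. ennreal (enn2real (\<Sum>n. ennreal (f (e n) x))) = (\<Sum>n. ennreal (f (e n) x))"
    by eventually_elim (use nn in \<open>simp add: suminf_ennreal2 suminf_nonneg\<close>)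
  have "(LINT x|M. enn2real (\<Sum>n. ennreal (f (e n) x))) =
      enn2real (\<integral>\<^sup>+x. ennreal (enn2real (\<Sum>n. ennreal (f (e n) x))) \<partial>M)"
    by (rule integral_eq_nn_integral) auto
  also have "(\<integral>\<^sup>+x. ennreal (enn2real (\<Sum>n. ennreal (f (e n) x))) \<partial>M) = (\<integral>\<^sup>+x. (\<Sum>n. ennreal (f (e n) x)) \<partial>M)"
    by (rule nn_integral_cong_AE[OF ae])
  also have "\<dots> = (\<Sum>n. \<integral>\<^sup>+x. ennreal (f (e n) x) \<partial>M)"
    by (intro nn_integral_suminf) measurable
  also have "\<dots> = (\<Sum>n. ennreal (LINT x|M. f (e n) x))"
    using i nn by (intro suminf_cong nn_integral_eq_integral) auto
  also have "enn2real \<dots> = infsum (\<lambda>n. LINT x|M. f (e n) x) UNIV"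
    using nn by (intro infsum_eq_enn2real_suminf[symmetric]) (simp add: integral_nonneg)
  also have "\<dots> = (\<Sum>\<^sub>\<infinity>j. LINT x|M. f j x)"
    by (rule re[symmetric])
  finally show ?thesis by (simp add: eq)
qed

lemma integral_infsum_bounded:
  fixes f :: "'i::countable \<Rightarrow> 'a \<Rightarrow> 'b::{banach, second_countable_topology}"
  assumes inf: "infinite (UNIV :: 'i set)" and fin: "finite_measure M"
    and m: "\<And>j. f j \<in> borel_measurable M"
    and b: "\<And>j x. norm (f j x) \<le> B j" and s: "B summable_on UNIV"
  shows "integrable M (\<lambda>x. \<Sum>\<^sub>\<infinity>j. f j x)" "((\<lambda>j. LINT x|M. f j x) has_sum (LINT x|M. (\<Sum>\<^sub>\<infinity>j. f j x))) UNIV"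
proof -
  interpret finite_measure M by fact
  note [measurable] = m
  define e where "e = from_nat_into (UNIV :: 'i set)"
  have e: "bij_betw e UNIV UNIV"
    unfolding e_def using inf by (intro bij_betw_from_nat_into) auto
  have i: "integrable M (f j)" for j
    by (rule integrable_const_bound[of _ "B j"]) (auto simp: b)
  have se: "summable (\<lambda>n. B (e n))"
    using s summable_on_reindex_bij_betw[OF e, of B] by (simp add: summable_on_imp_summable)
  have to_suminf: "(g has_sum (\<Sum>n. g (e n))) UNIV" if "\<And>j. norm (g j) \<le> B j * C" for g :: "'i \<Rightarrow> 'b" and C
  proof -
    have "(\<lambda>j. norm (g j)) summable_on UNIV"
      by (rule Infinite_Sum.abs_summable_on_comparison_test'[OF _ that]) (intro summable_on_cmult_left s)
    then have "(g has_sum infsum g UNIV) UNIV"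
      by (simp add: Infinite_Sum.abs_summable_summable)
    moreover from this have "((\<lambda>n. g (e n)) has_sum infsum g UNIV) UNIV"
      unfolding has_sum_reindex_bij_betw[OF e, of g] .
    then have "infsum g UNIV = (\<Sum>n. g (e n))"
      by (intro sums_unique has_sum_imp_sums)
    ultimately show ?thesis by simp
  qed
  have eq: "(\<Sum>\<^sub>\<infinity>j. f j x) = (\<Sum>n. f (e n) x)" for x
    by (rule infsumI, rule to_suminf[where C = 1]) (simp add: b)
  have s1: "summable (\<lambda>n. norm (f (e n) x))" for x
    by (rule summable_comparison_test'[OF se]) (simp add: b)
  have nb: "(LINT x|M. norm (f j x)) \<le> B j * measure M (space M)" for j
  proof -
    have "(LINT x|M. norm (f j x)) \<le> (LINT x|M. B j)"
      by (intro integral_mono integrable_norm i b) auto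
    then show ?thesis by (simp add: mult.commute)
  qed
  have s2: "summable (\<lambda>n. LINT x|M. norm (f (e n) x))"
    by (rule summable_comparison_test'[OF summable_mult2[OF se, of "measure M (space M)"]])
      (use nb in \<open>simp add: integral_nonneg\<close>)
  show "integrable M (\<lambda>x. \<Sum>\<^sub>\<infinity>j. f j x)"
    unfolding eq by (rule integrable_suminf) (use i s1 s2 in auto)
  have "(LINT x|M. (\<Sum>\<^sub>\<infinity>j. f j x)) = (\<Sum>n. LINT x|M. f (e n) x)"
    unfolding eq by (rule integral_suminf) (use i s1 s2 in auto)
  then show "((\<lambda>j. LINT x|M. f j x) has_sum (LINT x|M. (\<Sum>\<^sub>\<infinity>j. f j x))) UNIV"
    using to_suminf[of "\<lambda>j. LINT x|M. f j x" "measure M (space M)"]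
    by (auto intro: order.trans[OF integral_norm_bound nb])
qed

section \<open>Free evolution of the autocorrelations\<close>

lemma summable_on_shift:
  fixes f :: "int \<Rightarrow> real"
  assumes "f summable_on UNIV" shows "(\<lambda>k. f (k + m)) summable_on UNIV"
proof -
  have "bij_betw (\<lambda>k. k + m) UNIV UNIV" by (rule bij_betwI[of _ _ _ "\<lambda>k. k - m"]) auto
  from summable_on_reindex_bij_betw[OF this, of f] show ?thesis using assms by simp
qed

lemma ell2_shift_product_summable:
  assumes "ell2 a" shows "(\<lambda>k. cmod (a (k + m)) * cmod (a k)) summable_on UNIV"
proof -
  have "(\<lambda>k. norm (cmod (a (k + m)) * cmod (a k))) summable_on UNIV"
  proof (rule Infinite_Sum.abs_summable_on_comparison_test')
    show "(\<lambda>k. (cmod (a (k + m)))\<^sup>2 + (cmod (a k))\<^sup>2) summable_on UNIV"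
      using assms unfolding ell2_def by (intro summable_on_add summable_on_shift[where f = "\<lambda>k. (cmod (a k))\<^sup>2"])
    show "norm (cmod (a (k + m)) * cmod (a k)) \<le> (cmod (a (k + m)))\<^sup>2 + (cmod (a k))\<^sup>2" for k
      using cmod_mult_le_squares[of "a (k + m)" "a k"] by (simp add: norm_mult)
  qed
  then show ?thesis by simp
qed

definition phase :: "real \<Rightarrow> real \<Rightarrow> int \<Rightarrow> complex" where
  "phase L r k = exp (- \<i> * complex_of_real (4 * pi\<^sup>2 * (real_of_int k)\<^sup>2 * r / L\<^sup>2))"

lemma phase_cis: "phase L r k = cis (- (4 * pi\<^sup>2 / L\<^sup>2) * (of_int k)\<^sup>2 * r)"
  by (simp add: phase_def cis_conv_exp)

text \<open>The identity \<open>(k + m)^2 - k^2 - (l + m)^2 + l^2 = 2 * m * (k - l)\<close>: this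
  factorisation is the source of decay in both differences.\<close>

lemma corr_phase_term:
  "phase L r (k + m) * cnj (phase L r k) * cnj (phase L r (l + m) * cnj (phase L r l)) =
     cis (- (8 * pi\<^sup>2 / L\<^sup>2) * of_int (m * (k - l)) * r)"
proof -
  define \<theta> where "\<theta> = 4 * pi\<^sup>2 / L\<^sup>2"
  have "phase L r (k + m) * cnj (phase L r k) * cnj (phase L r (l + m) * cnj (phase L r l)) =
      cis (- \<theta> * ((of_int (k + m))\<^sup>2 - (of_int k)\<^sup>2 - (of_int (l + m))\<^sup>2 + (of_int l)\<^sup>2) * r)"
    unfolding phase_cis \<theta>_def[symmetric] by (simp add: cis_cnj cis_mult algebra_simps)
  also have "(of_int (k + m))\<^sup>2 - (of_int k)\<^sup>2 - (of_int (l + m))\<^sup>2 + (of_int l)\<^sup>2 = 2 * real_of_int (m * (k - l))"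
    by (simp add: power2_eq_square algebra_simps)
  also have "- \<theta> * (2 * real_of_int (m * (k - l))) = - (8 * pi\<^sup>2 / L\<^sup>2) * of_int (m * (k - l))"
    by (simp add: \<theta>_def)
  finally show ?thesis .
qed

lemma norm_phase [simp]: "cmod (phase L r k) = 1"
  by (simp add: phase_cis)

text \<open>For fixed \<open>m\<close> the double sum over \<open>(k, l)\<close> has a majorant
  independent of \<open>r\<close>, because the phases have modulus one. Summed over \<open>m\<close>
  this majorant may diverge, so the remaining sum is left to an argument by positivity.\<close>

lemma integral_corr_square:
  fixes a :: "int \<Rightarrow> complex"
  assumes L: "L > 0" and a: "ell2 a"
  defines "P \<equiv> \<lambda>m r. (cmod (corr (\<lambda>k. phase L r k * a k) m))\<^sup>2"
  shows "integrable (torus 1) (P m)"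
    and "((\<lambda>(k, l). qterm L a a a a (m, k, l)) has_sum complex_of_real (LINT r|torus 1. P m r)) UNIV"
proof -
  define t where "t r k = phase L r (k + m) * a (k + m) * cnj (phase L r k * a k)" for r k
  define f where "f p r = (case p of (k, l) \<Rightarrow> t r k * cnj (t r l))" for p r
  define B where "B p = (case p of (k, l) \<Rightarrow> cmod (a (k + m)) * cmod (a k) * (cmod (a (l + m)) * cmod (a l)))" for p
  have tn: "cmod (t r k) = cmod (a (k + m)) * cmod (a k)" for r k
    by (simp add: t_def norm_mult)
  have ts: "(\<lambda>k. norm (t r k)) summable_on UNIV" for r
    unfolding tn by (rule ell2_shift_product_summable[OF a])
  have th: "(t r has_sum corr (\<lambda>k. phase L r k * a k) m) UNIV" for r
    using Infinite_Sum.abs_summable_summable[OF ts[of r]]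
    by (simp add: corr_def t_def[abs_def])
  have fh: "((\<lambda>p. f p r) has_sum of_real (P m r)) UNIV" for r
  proof -
    have "((\<lambda>(k, l). t r k * cnj (t r l)) has_sum corr (\<lambda>k. phase L r k * a k) m * cnj (corr (\<lambda>k. phase L r k * a k) m)) UNIV"
      by (rule has_sum_times(1)) (use th ts in \<open>auto simp: has_sum_cnj_iff\<close>)
    then show ?thesis by (simp add: P_def f_def complex_norm_square del: of_real_power)
  qed
  have feq: "f (k, l) r = a (k + m) * cnj (a k) * cnj (a (l + m)) * a l * cis (- (8 * pi\<^sup>2 / L\<^sup>2) * of_int (m * (k - l)) * r)" for k l r
    unfolding corr_phase_term[symmetric] by (simp add: f_def t_def mult_ac)
  have fm: "f p \<in> borel_measurable (torus 1)" for p
  proof (cases p)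
    case (Pair k l)
    show ?thesis
      unfolding Pair feq
      by (intro measurable_torus borel_measurable_continuous_onI continuous_intros)
  qed
  have fb: "norm (f p r) \<le> B p" for p r
    by (cases p) (simp add: f_def B_def norm_mult tn)
  have "(\<lambda>(k, l). norm (cmod (a (k + m)) * cmod (a k) * (cmod (a (l + m)) * cmod (a l)))) summable_on UNIV"
    by (rule has_sum_times(2)[OF has_sum_infsum has_sum_infsum]) (use ell2_shift_product_summable[OF a] in auto)
  then have Bs: "B summable_on UNIV"
    by (simp add: B_def[abs_def] case_prod_unfold)
  have inf: "infinite (UNIV :: (int \<times> int) set)"
    by (simp add: finite_prod)
  note I = integral_infsum_bounded[OF inf finite_measure_torus fm fb Bs]
  have Peq: "(\<Sum>\<^sub>\<infinity>p. f p r) = of_real (P m r)" for r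
    using fh by (rule infsumI)
  have "integrable (torus 1) (\<lambda>r. complex_of_real (P m r))"
    using I(1) by (simp add: Peq)
  then show "integrable (torus 1) (P m)"
    using integrable_Re by fastforce
  have "(LINT r|torus 1. f (k, l) r) = qterm L a a a a (m, k, l)" for k l
    unfolding feq by (simp add: qterm_def osc_def)
  then have "(\<lambda>p. LINT r|torus 1. f p r) = (\<lambda>(k, l). qterm L a a a a (m, k, l))" by auto
  then show "((\<lambda>(k, l). qterm L a a a a (m, k, l)) has_sum complex_of_real (LINT r|torus 1. P m r)) UNIV"
    using I(2) by (simp add: Peq)
qed

lemma integral_infsum_corr_square:
  assumes L: "L > 0" and a: "ell2 a"
  shows "complex_of_real (LINT r|torus 1. (\<Sum>\<^sub>\<infinity>m. (cmod (corr (\<lambda>k. phase L r k * a k) m))\<^sup>2)) = quad L a a a a"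
proof -
  let ?P = "\<lambda>m r. (cmod (corr (\<lambda>k. phase L r k * a k) m))\<^sup>2"
  have "(qterm L a a a a has_sum quad L a a a a) (UNIV \<times> UNIV)"
    using qterm_summable(2)[OF L a a a a] by (simp add: quad_def)
  \<comment> \<open>Summability over \<open>m\<close> is not visible at fixed time; it is inherited
    from the absolute convergence of \<open>quad\<close>, where the oscillation in time has already
    been integrated.\<close>
  then have s: "((\<lambda>m. complex_of_real (LINT r|torus 1. ?P m r)) has_sum quad L a a a a) UNIV"
    by (rule has_sum_SigmaD) (use integral_corr_square(2)[OF L a] in \<open>simp add: case_prod_unfold\<close>)
  then have "(\<lambda>m. Re (complex_of_real (LINT r|torus 1. ?P m r))) summable_on UNIV"
    by (intro summable_on_Re has_sum_imp_summable)
  then have s': "(\<lambda>m. LINT r|torus 1. ?P m r) summable_on UNIV" by simp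
  have "(LINT r|torus 1. (\<Sum>\<^sub>\<infinity>m. ?P m r)) = (\<Sum>\<^sub>\<infinity>m. LINT r|torus 1. ?P m r)"
    using integral_corr_square(1)[OF L a] s' by (intro integral_infsum_nonneg) (auto simp: infinite_UNIV_int)
  moreover have "((\<lambda>m. complex_of_real (LINT r|torus 1. ?P m r)) has_sum of_real (\<Sum>\<^sub>\<infinity>m. LINT r|torus 1. ?P m r)) UNIV"
    using s' by (intro has_sum_of_real) auto
  from has_sum_unique[OF this s]
  have "complex_of_real (\<Sum>\<^sub>\<infinity>m. LINT r|torus 1. ?P m r) = quad L a a a a" .
  ultimately show ?thesis by simp
qed

lemma propagator_props:
  assumes L: "L > 0" and f: "sqint L f"
  shows "propagator L r f \<in> L2_torus L"
    "fourier L (propagator L r f) = (\<lambda>k. phase L r k * fourier L f k)"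
proof -
  have "(\<lambda>k. (cmod (phase L r k * fourier L f k))\<^sup>2) summable_on UNIV"
    using fourier_square_summable[OF L f] by (simp add: norm_mult)
  from riesz_fischer[OF L this] obtain g
    where g: "g \<in> L2_torus L" "\<And>k. fourier L g k = phase L r k * fourier L f k"
    by blast
  define A where "A h \<longleftrightarrow> h \<in> L2_torus L \<and> (\<forall>k. fourier L h k = phase L r k * fourier L f k)" for h
  have "propagator L r f = (SOME h. A h)"
    unfolding propagator_def A_def phase_def ..
  moreover have "A (SOME h. A h)"
    by (rule someI[of A g]) (use g in \<open>simp add: A_def\<close>)
  ultimately have "A (propagator L r f)" by simp
  then have "propagator L r f \<in> L2_torus L \<and>
      (\<forall>k. fourier L (propagator L r f) k = phase L r k * fourier L f k)"
    by (simp add: A_def)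
  then show "propagator L r f \<in> L2_torus L"
    "fourier L (propagator L r f) = (\<lambda>k. phase L r k * fourier L f k)" by auto
qed

lemma ell2_fourier: "L > 0 \<Longrightarrow> sqint L f \<Longrightarrow> ell2 (fourier L f)"
  using fourier_square_summable by (simp add: ell2_def)

theorem Q_form_eq_quad:
  assumes L: "L > 0" and f: "sqint L f"
  shows "Q_form L f f f f = quad L (fourier L f) (fourier L f) (fourier L f) (fourier L f) / of_real L"
proof -
  let ?a = "fourier L f"
  have "(LINT x:{0..L}|lborel. cnj (propagator L r f x) * propagator L r f x *
        cnj (propagator L r f x) * propagator L r f x) =
      of_real ((\<Sum>\<^sub>\<infinity>m. (cmod (corr (\<lambda>k. phase L r k * ?a k) m))\<^sup>2) / L)" for r
  proof -
    let ?p = "propagator L r f"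
    have "cnj z * z * cnj z * z = of_real (cmod z ^ 4)" for z
    proof -
      have "cnj z * z * cnj z * z = (z * cnj z) ^ 2" by (simp add: power2_eq_square)
      also have "\<dots> = of_real (cmod z ^ 4)"
        unfolding complex_norm_square[symmetric] by (simp flip: power_mult)
      finally show ?thesis .
    qed
    then have "(LINT x:{0..L}|lborel. cnj (?p x) * ?p x * cnj (?p x) * ?p x) =
        of_real (LINT x|torus L. cmod (?p x) ^ 4)"
      by (simp add: set_integral_torus del: of_real_power)
    then show ?thesis
      using integral_norm_power4[OF L L2_torus_sqint[OF propagator_props(1)[OF L f]]]
      by (simp add: propagator_props(2)[OF L f])
  qed
  then have "Q_form L f f f f = (LINT r|torus 1. 
      of_real ((\<Sum>\<^sub>\<infinity>m. (cmod (corr (\<lambda>k. phase L r k * ?a k) m))\<^sup>2) / L))"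
    by (simp add: Q_form_def set_integral_torus del: of_real_divide)
  also have "\<dots> = of_real (LINT r|torus 1. (\<Sum>\<^sub>\<infinity>m. (cmod (corr (\<lambda>k. phase L r k * ?a k) m))\<^sup>2)) / of_real L"
    by (simp del: of_real_divide add: of_real_divide[symmetric])
  finally show ?thesis
    unfolding integral_infsum_corr_square[OF L ell2_fourier[OF L f]] .
qed

section \<open>The Euler--Lagrange equation\<close>

abbreviation mass :: "(int \<Rightarrow> complex) \<Rightarrow> real" where
  "mass u \<equiv> (\<Sum>\<^sub>\<infinity>k. (cmod (u k))\<^sup>2)"

lemma L2_norm_fourier:
  assumes "L > 0" "sqint L f" shows "L2_norm L f = sqrt (mass (fourier L f))"
  using infsumI[OF parseval[OF assms]] by (simp add: L2_norm_def set_integral_torus)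

text \<open>Gives \<open>omega1\<close> its meaning: \<open>SUP\<close> of a set of reals without an
  upper bound is unspecified.\<close>

lemma bdd_above_Q_form:
  assumes L: "L > 0"
  shows "bdd_above ((\<lambda>f. Re (Q_form L f f f f)) ` {f \<in> L2_torus L. L2_norm L f = 1})"
proof (rule bdd_aboveI2)
  fix f assume "f \<in> {f \<in> L2_torus L. L2_norm L f = 1}"
  then have f: "sqint L f" "L2_norm L f = 1" by (auto intro: L2_torus_sqint)
  let ?a = "fourier L f"
  have "Re (Q_form L f f f f) \<le> cmod (quad L ?a ?a ?a ?a) / L"
    using complex_Re_le_cmod[of "Q_form L f f f f"] L by (simp add: Q_form_eq_quad f norm_divide)
  also have "\<dots> \<le> 2 * infsum (osc_weight L) UNIV * (mass ?a)\<^sup>2 / L"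
    using L by (intro divide_right_mono norm_quad_le ell2_fourier f) auto
  also have "mass ?a = 1"
    using f L by (simp add: L2_norm_fourier)
  finally show "Re (Q_form L f f f f) \<le> 2 * infsum (osc_weight L) UNIV * 1\<^sup>2 / L" .
qed

text \<open>Homogeneity of degree four extends the bound from the unit sphere to all sequences, and
  Riesz-Fischer realises the normalised sequence by a function. The zero sequence cannot be
  normalised and is treated apart.\<close>

lemma quad_le_omega1:
  assumes L: "L > 0" and b: "ell2 b"
  shows "Re (quad L b b b b) \<le> omega1 L * L * (mass b)\<^sup>2"
proof (cases "mass b = 0")
  case True
  have "(cmod (b k))\<^sup>2 = 0" for k
    by (rule nonneg_infsum_le_0D[where A = UNIV and f = "\<lambda>k. (cmod (b k))\<^sup>2"])
      (use True b in \<open>auto simp: ell2_def\<close>)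
  then have "b = (\<lambda>k. 0 * b k)" by auto
  then have "quad L b b b b = 0" using quad_cmult(1)[of L 0 b b b b] by simp
  then show ?thesis using True by simp
next
  case False
  define s where "s = mass b"
  have "s \<ge> 0" unfolding s_def by (rule infsum_nonneg) simp
  then have s: "s > 0" using False by (simp add: s_def)
  define c where "c = complex_of_real (1 / sqrt s)"
  have c2: "(cmod c)\<^sup>2 = 1 / s" using s by (simp add: c_def norm_divide power_divide)
  have cb: "(\<lambda>k. (cmod (c * b k))\<^sup>2) summable_on UNIV"
    using ell2_cmult[OF b, of c] by (simp add: ell2_def)
  from riesz_fischer[OF L cb] obtain g where g: "g \<in> L2_torus L" "\<And>k. fourier L g k = c * b k"
    by blast
  then have fg: "fourier L g = (\<lambda>k. c * b k)" by auto
  have sg: "sqint L g" using g(1) by (rule L2_torus_sqint)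
  have "mass (\<lambda>k. c * b k) = (cmod c)\<^sup>2 * s"
    by (simp add: s_def norm_mult power_mult_distrib infsum_cmult_right')
  then have n: "L2_norm L g = 1"
    using s by (simp add: L2_norm_fourier[OF L sg] fg c2)
  have "cnj c = c" by (simp add: c_def)
  moreover have "c * c = of_real (1 / s)" using s by (simp add: c_def flip: of_real_mult)
  ultimately have "c * (c * (c * (c * z))) = z / of_real (s\<^sup>2)" for z
    by (simp add: power2_eq_square flip: mult.assoc)
  then have "Q_form L g g g g = quad L b b b b / of_real (s\<^sup>2) / of_real L"
    using \<open>cnj c = c\<close> by (simp add: Q_form_eq_quad[OF L sg] fg quad_cmult)
  then have "Re (Q_form L g g g g) = Re (quad L b b b b) / s\<^sup>2 / L"
    by (simp only: Re_divide_of_real)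
  then have "Re (quad L b b b b) = Re (Q_form L g g g g) * (L * s\<^sup>2)"
    using s L by simp
  also have "\<dots> \<le> omega1 L * (L * s\<^sup>2)"
  proof (rule mult_right_mono)
    show "Re (Q_form L g g g g) \<le> omega1 L"
    unfolding omega1_def by (rule cSUP_upper[OF _ bdd_above_Q_form[OF L]]) (use g n in auto)
  qed (use L in simp)
  finally show ?thesis by (simp add: s_def mult.assoc)
qed

text \<open>Stands in for differentiation at a maximum: along a line the form is exactly a quartic
  polynomial, so the first-order condition concerns a polynomial that is nonnegative and vanishes at
  0.\<close>

lemma poly4_nonneg_imp_linear_coeff_zero:
  fixes c1 c2 c3 c4 :: real
  assumes "\<And>t. c1 * t + c2 * t ^ 2 + c3 * t ^ 3 + c4 * t ^ 4 \<ge> 0"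
  shows "c1 = 0"
proof -
  define p where "p t = c1 + c2 * t + c3 * t ^ 2 + c4 * t ^ 3" for t
  have tp: "t * p t \<ge> 0" for t
    using assms[of t] by (simp add: p_def power2_eq_square power3_eq_cube power4_eq_xxxx algebra_simps)
  have sg: "t > 0 \<Longrightarrow> p t \<ge> 0" "t < 0 \<Longrightarrow> p t \<le> 0" for t
    using tp[of t] by (simp_all add: zero_le_mult_iff)
  have "isCont p 0" unfolding p_def by (intro continuous_intros)
  then have lim: "(p \<longlongrightarrow> c1) (at 0)" by (simp add: isCont_def p_def)
  have "(p \<longlongrightarrow> c1) (at_right 0)" "(p \<longlongrightarrow> c1) (at_left 0)"
    using lim by (simp_all add: filterlim_at_split)
  moreover have "\<forall>\<^sub>F t in at_right 0. p t \<ge> 0"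
    using eventually_at_right_less[of 0] by eventually_elim (rule sg)
  moreover have "\<forall>\<^sub>F t in at_left 0. p t \<le> 0"
    using eventually_at_left_real[of "-1" "0::real", simplified]
    by eventually_elim (auto intro: sg)
  ultimately have "c1 \<ge> 0" "c1 \<le> 0"
    by (auto intro: tendsto_lowerbound tendsto_upperbound)
  then show ?thesis by simp
qed

text \<open>The part of \<open>qterm\<close> with \<open>k = j\<close>, written with
  \<open>i = j - l\<close>; the resonances are then the two axes \<open>m = 0\<close> and
  \<open>i = 0\<close>.\<close>

definition euler_term :: "real \<Rightarrow> (int \<Rightarrow> complex) \<Rightarrow> int \<Rightarrow> int \<times> int \<Rightarrow> complex" where
  "euler_term L a j = (\<lambda>(m, i). a (j + m) * cnj (a (j - i + m)) * a (j - i) * osc L (m * i))"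

lemma single_has_sum: "((\<lambda>k. if k = j then c else 0) has_sum c) UNIV"
  by (rule has_sum_finite_neutralI[of "{j}"]) auto

lemma quad_single:
  "quad L a (\<lambda>k. if k = j then u else 0) a a = cnj u * infsum (euler_term L a j) UNIV"
proof -
  let ?v = "\<lambda>k. if k = j then u else 0"
  let ?S = "{x :: int \<times> int \<times> int. fst (snd x) = j}"
  have "quad L a ?v a a = infsum (qterm L a ?v a a) ?S"
    unfolding quad_def by (rule infsum_cong_neutral) (auto simp: qterm_def)
  also have "\<dots> = infsum (\<lambda>x. cnj u * euler_term L a j x) UNIV"
    by (rule infsum_reindex_bij_witness[where j = "\<lambda>(m, k, l). (m, j - l)" and i = "\<lambda>(m, i). (m, j, j - i)"])
      (auto simp: qterm_def euler_term_def)
  also have "\<dots> = cnj u * infsum (euler_term L a j) UNIV"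
    by (rule infsum_cmult_right')
  finally show ?thesis .
qed

text \<open>The perturbed sequence is not renormalised: the squared mass on the right of the
  homogeneous inequality takes the place of the constraint, so \<open>\<Omega>\<close> comes out as
  the multiplier.\<close>

lemma first_variation:
  assumes L: "L > 0" and a: "ell2 a" and m: "mass a = 1"
    and max: "quad L a a a a = of_real \<Omega>"
    and le: "\<And>b. ell2 b \<Longrightarrow> Re (quad L b b b b) \<le> \<Omega> * (mass b)\<^sup>2"
    and u: "cmod u = 1"
  shows "\<Omega> * Re (a j * cnj u) = Re (cnj u * infsum (euler_term L a j) UNIV)"
proof -
  define v where "v = (\<lambda>k. if k = j then u else 0)"
  define \<rho> where "\<rho> = Re (a j * cnj u)"
  define T where "T = cnj u * infsum (euler_term L a j) UNIV"
  have vs: "((\<lambda>k. (cmod (v k))\<^sup>2) has_sum 1) UNIV"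
    using single_has_sum[of j "1::real"] u by (simp add: v_def if_distrib[of cmod] if_distrib[of "\<lambda>x. x\<^sup>2"] cong: if_cong)
  then have v: "ell2 v" by (auto simp: ell2_def has_sum_imp_summable)
  have mass: "mass (\<lambda>k. a k + of_real t * v k) = 1 + (2 * t * \<rho> + t\<^sup>2)" for t
  proof (rule infsumI)
    have "(cmod (a k + of_real t * v k))\<^sup>2 = (cmod (a k))\<^sup>2 + (if k = j then 2 * t * \<rho> + t\<^sup>2 else 0)" for k
    proof (cases "k = j")
      case True
      have "(Re u)\<^sup>2 + (Im u)\<^sup>2 = 1" using u by (metis cmod_power2 one_power2)
      then have "t\<^sup>2 * ((Re u)\<^sup>2 + (Im u)\<^sup>2) = t\<^sup>2" by simp
      moreover have "(cmod (z + of_real t * w))\<^sup>2 = (cmod z)\<^sup>2 + 2 * t * Re (z * cnj w) + t\<^sup>2 * ((Re w)\<^sup>2 + (Im w)\<^sup>2)" for z w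
        unfolding cmod_power2 by (simp add: power2_eq_square algebra_simps)
      ultimately show ?thesis
        using True by (simp add: v_def \<rho>_def)
    qed (simp add: v_def)
    moreover have "((\<lambda>k. (cmod (a k))\<^sup>2) has_sum 1) UNIV"
      using a m by (simp add: ell2_def has_sum_iff)
    ultimately show "((\<lambda>k. (cmod (a k + of_real t * v k))\<^sup>2) has_sum (1 + (2 * t * \<rho> + t\<^sup>2))) UNIV"
      by (simp only:) (intro has_sum_add single_has_sum)
  qed
  define S2 where "S2 = quad L v v a a + quad L v a v a + quad L v a a v + quad L a v v a + quad L a v a v + quad L a a v v"
  define S3 where "S3 = quad L v v v a + quad L v v a v + quad L v a v v + quad L a v v v"
  have T: "quad L a v a a = T"
    unfolding T_def v_def by (rule quad_single)
  have T': "quad L v a a a = cnj T" "quad L a a a v = cnj T" "quad L a a v a = T"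
    using quad_cnj[of L v a a a] quad_swap[of L a a v a] quad_swap[of L a a a v] T by simp_all
  have expand: "quad L (\<lambda>k. a k + of_real t * v k) (\<lambda>k. a k + of_real t * v k)
      (\<lambda>k. a k + of_real t * v k) (\<lambda>k. a k + of_real t * v k) =
      of_real \<Omega> + of_real t * (2 * T + 2 * cnj T) + of_real (t ^ 2) * S2 + of_real (t ^ 3) * S3
      + of_real (t ^ 4) * quad L v v v v" for t
    by (simp add: quad_add quad_cmult L a v ell2_add ell2_cmult max T T' S2_def S3_def
        power2_eq_square power3_eq_cube power4_eq_xxxx algebra_simps)
  \<comment> \<open>The difference of the two sides of the inequality, using \<open>(1 + 2 * t *
    \<rho> + t^2)^2 = 1 + 4 * \<rho> * t + (4 * \<rho>^2 + 2) * t^2 + 4 * \<rho> * t^3 +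
    t^4\<close>; the constant terms cancel because \<open>a\<close> is a maximizer.\<close>
  have "(4 * \<Omega> * \<rho> - 4 * Re T) * t + (\<Omega> * (4 * \<rho>\<^sup>2 + 2) - Re S2) * t ^ 2 + (4 * \<Omega> * \<rho> - Re S3) * t ^ 3
      + (\<Omega> - Re (quad L v v v v)) * t ^ 4 \<ge> 0" for t
  proof -
    have "ell2 (\<lambda>k. a k + of_real t * v k)" by (intro ell2_add ell2_cmult a v)
    from le[OF this] have "\<Omega> + t * (4 * Re T) + t ^ 2 * Re S2 + t ^ 3 * Re S3 + t ^ 4 * Re (quad L v v v v)
        \<le> \<Omega> * (1 + (2 * t * \<rho> + t\<^sup>2))\<^sup>2"
      unfolding expand mass by (simp del: of_real_power)
    then show ?thesis
      by (simp add: power2_eq_square power3_eq_cube power4_eq_xxxx algebra_simps)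
  qed
  then have "4 * \<Omega> * \<rho> - 4 * Re T = 0" by (rule poly4_nonneg_imp_linear_coeff_zero)
  then show ?thesis by (simp add: \<rho>_def T_def)
qed

lemma euler_lagrange:
  assumes "L > 0" "ell2 a" "mass a = 1" "quad L a a a a = of_real \<Omega>"
    and "\<And>b. ell2 b \<Longrightarrow> Re (quad L b b b b) \<le> \<Omega> * (mass b)\<^sup>2"
  shows "of_real \<Omega> * a j = infsum (euler_term L a j) UNIV"
  using first_variation[OF assms, of 1 j] first_variation[OF assms, of \<i> j]
  by (simp add: complex_eq_iff)

text \<open>Splitting off finitely many \<open>m\<close> and finitely many \<open>x + m\<close>, at least one factor is small in \<open>\<ell>\<^sup>2\<close>.\<close>

lemma convolution_vanishes:
  fixes h b :: "int \<Rightarrow> real"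
  assumes h: "(\<lambda>m. (h m)\<^sup>2) summable_on UNIV" and b: "(\<lambda>m. (b m)\<^sup>2) summable_on UNIV"
    and nn: "\<And>m. h m \<ge> 0" "\<And>m. b m \<ge> 0" and \<epsilon>: "\<epsilon> > 0"
  shows "\<exists>X. \<forall>x. \<bar>x\<bar> \<ge> X \<longrightarrow> (\<Sum>\<^sub>\<infinity>m. h m * b (x + m)) \<le> \<epsilon>"
proof -
  define H B where "H = (\<Sum>\<^sub>\<infinity>m. (h m)\<^sup>2)" and "B = (\<Sum>\<^sub>\<infinity>m. (b m)\<^sup>2)"
  have HB: "H \<ge> 0" "B \<ge> 0" by (auto simp: H_def B_def intro: infsum_nonneg)
  \<comment> \<open>The bound below splits into \<open>\<delta> * (H + B)\<close>, at most
    \<open>\<epsilon> / 2\<close> by this choice, and two tails divided by \<open>\<delta>\<close>,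
    for which \<open>n\<close> is chosen next.\<close>
  define \<delta> where "\<delta> = \<epsilon> / (2 * (H + B + 1))"
  have \<delta>: "\<delta> > 0" using HB \<epsilon> by (simp add: \<delta>_def)
  have \<delta>HB: "\<delta> * (H + B) \<le> \<epsilon> / 2"
    using HB \<epsilon> by (simp add: \<delta>_def field_simps)
  obtain n where n: "(1 / 4) ^ n < \<epsilon> * \<delta> / 4"
    using real_arch_pow_inv[of "\<epsilon> * \<delta> / 4" "1 / 4"] \<epsilon> \<delta> by auto
  obtain F where F: "finite F" "H \<le> (\<Sum>m\<in>F. (h m)\<^sup>2) + (1 / 4) ^ n"
    using exhausting_finite_sets[OF h] unfolding H_def by (metis zero_le_power2)
  obtain G where G: "finite G" "B \<le> (\<Sum>m\<in>G. (b m)\<^sup>2) + (1 / 4) ^ n"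
    using exhausting_finite_sets[OF b] unfolding B_def by (metis zero_le_power2)
  \<comment> \<open>For \<open>x\<close> outside this finite set of differences, the translate of
    \<open>F\<close> by \<open>x\<close> misses \<open>G\<close>, so on \<open>F\<close> the shifted
    sequence contributes only from the tail of \<open>b\<close>.\<close>
  define D where "D = (\<lambda>(m, k). k - m) ` (F \<times> G)"
  have D: "finite D" using F G by (simp add: D_def)
  have "(\<Sum>\<^sub>\<infinity>m. h m * b (x + m)) \<le> \<epsilon>" if x: "x \<notin> D" for x
  proof -
    define c where "c m = b (x + m)" for m
    have cs: "((\<lambda>m. (c m)\<^sup>2) has_sum B) UNIV"
    proof -
      have "bij_betw (\<lambda>m. x + m) UNIV UNIV" by (rule bij_betwI[of _ _ _ "\<lambda>k. k - x"]) auto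
      from has_sum_reindex_bij_betw[OF this, of "\<lambda>k. (b k)\<^sup>2" B] show ?thesis
        using b by (simp add: c_def B_def)
    qed
    have hs: "((\<lambda>m. (h m)\<^sup>2) has_sum H) UNIV" using h by (simp add: H_def)
    \<comment> \<open>Weighted AM-GM with the large weight \<open>1 / \<delta>\<close> on whichever
      factor is small: the shifted sequence on \<open>F\<close>, and \<open>h\<close> off
      \<open>F\<close>. The \<open>if\<close> performs the exchange as a finite correction.\<close>
    define p where "p m = \<delta> * (h m)\<^sup>2 + \<delta> * (c m)\<^sup>2 + (1 / \<delta>) * ((h m)\<^sup>2 + (if m \<in> F then (c m)\<^sup>2 - (h m)\<^sup>2 else 0))" for m
    define S where "S = \<delta> * H + \<delta> * B + (1 / \<delta>) * (H + (\<Sum>m\<in>F. (c m)\<^sup>2 - (h m)\<^sup>2))"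
    have ps: "(p has_sum S) UNIV"
      unfolding p_def[abs_def] S_def
      by (intro has_sum_add has_sum_cmult_right hs cs has_sum_finite_neutralI[of F]) (auto simp: F)
    have am: "y * z \<le> \<delta> * y\<^sup>2 + (1 / \<delta>) * z\<^sup>2" if "y \<ge> 0" "z \<ge> 0" for y z
    proof -
      have "\<delta> * (y * z) \<le> 2 * (\<delta> * y) * z" using that \<delta> by simp
      also have "\<dots> \<le> (\<delta> * y)\<^sup>2 + z\<^sup>2" by (rule sum_squares_bound)
      also have "\<dots> = \<delta> * (\<delta> * y\<^sup>2 + (1 / \<delta>) * z\<^sup>2)" using \<delta> by (simp add: field_simps power2_eq_square)
      finally show ?thesis using \<delta> by simp
    qed
    have cn: "c m \<ge> 0" for m by (simp add: c_def nn)
    have le: "h m * c m \<le> p m" for m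
    proof (cases "m \<in> F")
      case True
      have "0 \<le> \<delta> * (c m)\<^sup>2" using \<delta> by simp
      then show ?thesis using True am[of "h m" "c m"] nn(1)[of m] cn[of m] by (simp add: p_def)
    next
      case False
      have "0 \<le> \<delta> * (h m)\<^sup>2" using \<delta> by simp
      then show ?thesis using False am[of "c m" "h m"] nn(1)[of m] cn[of m] by (simp add: p_def mult.commute)
    qed
    have "(\<lambda>m. norm (h m * c m)) summable_on UNIV"
      by (rule Infinite_Sum.abs_summable_on_comparison_test'[OF has_sum_imp_summable[OF ps]])
        (use le nn cn in simp)
    then have "(\<lambda>m. h m * c m) summable_on UNIV" by (rule Infinite_Sum.abs_summable_summable)
    then have "(\<Sum>\<^sub>\<infinity>m. h m * c m) \<le> S"
      using has_sum_mono[OF has_sum_infsum ps] le by blast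
    also have "S = \<delta> * (H + B) + (1 / \<delta>) * ((H - (\<Sum>m\<in>F. (h m)\<^sup>2)) + (\<Sum>m\<in>F. (c m)\<^sup>2))"
      by (simp add: S_def sum_subtractf algebra_simps)
    also have "\<dots> \<le> \<epsilon> / 2 + (1 / \<delta>) * ((1 / 4) ^ n + (1 / 4) ^ n)"
    proof (intro add_mono mult_left_mono \<delta>HB)
      show "H - (\<Sum>m\<in>F. (h m)\<^sup>2) \<le> (1 / 4) ^ n" using F by simp
      have "(\<Sum>m\<in>F. (c m)\<^sup>2) = (\<Sum>k\<in>(+) x ` F. (b k)\<^sup>2)"
        by (subst sum.reindex) (auto simp: c_def)
      moreover have "(\<Sum>k\<in>G \<union> (+) x ` F. (b k)\<^sup>2) = (\<Sum>k\<in>G. (b k)\<^sup>2) + (\<Sum>k\<in>(+) x ` F. (b k)\<^sup>2)"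
        using x F G by (intro sum.union_disjoint) (force simp: D_def image_iff)+
      moreover have "(\<Sum>k\<in>G \<union> (+) x ` F. (b k)\<^sup>2) \<le> B"
        unfolding B_def using b F G by (intro finite_sum_le_infsum) auto
      ultimately show "(\<Sum>m\<in>F. (c m)\<^sup>2) \<le> (1 / 4) ^ n" using G(2) by linarith
    qed (use \<delta> in auto)
    also have "\<dots> \<le> \<epsilon>" using n \<delta> by (simp add: field_simps)
    finally show ?thesis by (simp add: c_def)
  qed
  moreover have "x \<notin> D" if "\<bar>x\<bar> \<ge> (\<Sum>y\<in>D. \<bar>y\<bar>) + 1" for x
    using that member_le_sum[of x D abs] D by fastforce
  ultimately show ?thesis by blast
qed

section \<open>Decay of maximizers\<close>

lemma has_sum_pairI:
  fixes F :: "'a \<times> 'b \<Rightarrow> real"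
  assumes "\<And>x. ((\<lambda>y. F (x, y)) has_sum G x) UNIV" "(G has_sum S) UNIV" "\<And>x y. F (x, y) \<ge> 0"
  shows "(F has_sum S) UNIV"
proof -
  have "F summable_on UNIV \<times> UNIV"
    by (rule summable_on_SigmaI[where g = G]) (use assms in \<open>auto intro: has_sum_imp_summable\<close>)
  then have "(F has_sum S) (UNIV \<times> UNIV)"
    by (intro has_sum_SigmaI[where g = G]) (use assms in auto)
  then show ?thesis by simp
qed

lemma of_bool_zero_has_sum: "((\<lambda>i::int. of_bool (i = 0) * c :: real) has_sum c) UNIV"
  by (rule has_sum_finite_neutralI[of "{0}"]) auto

text \<open>The resonant terms are absorbed on the left, where \<open>\<Omega> - 2 \<ge> 2\<close>
  remains. The bound \<open>Q\<close> is pulled out of one factor at a frequency of size at least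
  \<open>|j| / 3\<close>; what is left does not involve \<open>Q\<close> and tends to 0, so any
  \<open>q\<close> can be reached.\<close>

lemma ell2_maximizer_decay_step:
  assumes L: "L > 0" and a: "ell2 a" and m: "mass a = 1" and \<Omega>: "\<Omega> \<ge> 4"
    and el: "\<And>j. of_real \<Omega> * a j = infsum (euler_term L a j) UNIV" and q: "q > 0"
  shows "\<exists>X. \<forall>j. \<bar>j\<bar> \<ge> X \<longrightarrow> (\<forall>Q. (\<forall>x. \<bar>j\<bar> \<le> 3 * \<bar>x\<bar> \<longrightarrow> cmod (a x) \<le> Q) \<longrightarrow> cmod (a j) \<le> q * Q)"
proof -
  define b where "b k = cmod (a k)" for k
  define h where "h = recip"
  have bn: "b k \<ge> 0" and hn: "h k \<ge> 0" for k by (simp_all add: b_def h_def)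
  have bs: "((\<lambda>k. (b k)\<^sup>2) has_sum 1) UNIV"
    using a m by (simp add: ell2_def has_sum_iff b_def)
  have hs: "(\<lambda>k. (h k)\<^sup>2) summable_on UNIV"
    unfolding h_def by (rule recip_square_summable)
  have bshift: "((\<lambda>k. (b (x + k))\<^sup>2) has_sum 1) UNIV" for x
  proof -
    have "bij_betw (\<lambda>k. x + k) UNIV UNIV" by (rule bij_betwI[of _ _ _ "\<lambda>k. k - x"]) auto
    from has_sum_reindex_bij_betw[OF this, of "\<lambda>k. (b k)\<^sup>2" 1] bs show ?thesis by simp
  qed
  define g where "g x = (\<Sum>\<^sub>\<infinity>m. h m * b (x + m))" for x
  define G where "G = (\<Sum>\<^sub>\<infinity>m. (h m)\<^sup>2) + 1"
  have maj: "h m * b (x + m) \<le> (h m)\<^sup>2 + (b (x + m))\<^sup>2" for x m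
  proof -
    have "h m * b (x + m) \<le> 2 * h m * b (x + m)" using bn hn by simp
    also have "\<dots> \<le> (h m)\<^sup>2 + (b (x + m))\<^sup>2" by (rule sum_squares_bound)
    finally show ?thesis .
  qed
  have majs: "((\<lambda>m. (h m)\<^sup>2 + (b (x + m))\<^sup>2) has_sum G) UNIV" for x
    unfolding G_def by (intro has_sum_add has_sum_infsum hs bshift)
  have gs: "((\<lambda>m. h m * b (x + m)) has_sum g x) UNIV" for x
  proof -
    have "(\<lambda>m. norm (h m * b (x + m))) summable_on UNIV"
      by (rule Infinite_Sum.abs_summable_on_comparison_test'[OF has_sum_imp_summable[OF majs[of x]]])
        (use maj bn hn in simp)
    then show ?thesis
      unfolding g_def by (rule has_sum_infsum[OF Infinite_Sum.abs_summable_summable])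
  qed
  have gs': "((\<lambda>m. h m * b (x - m)) has_sum g x) UNIV" for x
  proof -
    have "bij_betw uminus (UNIV :: int set) UNIV" by (rule bij_betwI[of _ _ _ uminus]) auto
    from has_sum_reindex_bij_betw[OF this, of "\<lambda>m. h m * b (x + m)" "g x"] gs[of x]
    show ?thesis by (simp add: h_def)
  qed
  have gn: "g x \<ge> 0" for x
    unfolding g_def using bn hn by (intro infsum_nonneg) auto
  have gG: "g x \<le> G" for x
    using has_sum_mono[OF gs majs] maj by blast
  have G: "G \<ge> 1" unfolding G_def by (simp add: infsum_nonneg)
  \<comment> \<open>The nested convolution needs no limit of its own: since \<open>g\<close> is
    bounded by \<open>G\<close>, both \<open>A j\<close> and \<open>g j * g j\<close> are at most
    \<open>G * g j\<close>, and only \<open>g\<close> has to vanish at infinity.\<close>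
  define A where "A j = (\<Sum>\<^sub>\<infinity>i. h i * b (j - i) * g (j - i))" for j
  have Ale: "h i * b (j - i) * g (j - i) \<le> G * (h i * b (j - i))" for i j
    using mult_left_mono[OF gG[of "j - i"], of "h i * b (j - i)"] bn hn by (simp add: mult.commute)
  have As: "((\<lambda>i. h i * b (j - i) * g (j - i)) has_sum A j) UNIV" for j
  proof -
    have "(\<lambda>i. norm (h i * b (j - i) * g (j - i))) summable_on UNIV"
      by (rule Infinite_Sum.abs_summable_on_comparison_test'[OF has_sum_imp_summable[OF has_sum_cmult_right[OF gs'[of j], of G]]])
        (use Ale bn hn gn in simp)
    then show ?thesis
      unfolding A_def by (rule has_sum_infsum[OF Infinite_Sum.abs_summable_summable])
  qed
  have AG: "A j \<le> G * g j" for j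
    using has_sum_mono[OF As has_sum_cmult_right[OF gs'[of j], of G]] Ale by blast
  have P1: "((\<lambda>(i, m). h i * b (j - i) * (h m * b (j - i + m))) has_sum A j) UNIV" for j
    by (rule has_sum_pairI[OF _ As])
      (use gs bn hn in \<open>auto intro: has_sum_cmult_right\<close>)
  \<comment> \<open>\<open>1\<close>, \<open>2\<close> and \<open>3\<close> sum the two factors that
    survive when \<open>Q\<close> replaces the one at \<open>j + m\<close>, \<open>j - i\<close> or
    \<open>j - i + m\<close> respectively. Exchanging \<open>m\<close> and \<open>i\<close> with a
    change of sign reduces the second to the first; the third factorises.\<close>
  have 1: "((\<lambda>(m, i). h m * h i * (b (j - i) * b (j - i + m))) has_sum A j) UNIV" for j
    by (rule has_sum_reindex_bij_witness[where j = "\<lambda>(m, i). (i, m)" and i = "\<lambda>(i, m). (m, i)",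
          THEN iffD2, OF _ _ _ _ _ refl P1[of j]]) (auto simp: mult_ac)
  have 2: "((\<lambda>(m, i). h m * h i * (b (j + m) * b (j - i + m))) has_sum A j) UNIV" for j
    by (rule has_sum_reindex_bij_witness[where j = "\<lambda>(m, i). (- m, - i)" and i = "\<lambda>(i, m). (- i, - m)",
          THEN iffD2, OF _ _ _ _ _ refl P1[of j]]) (auto simp: mult_ac h_def algebra_simps)
  have 3: "((\<lambda>(m, i). h m * h i * (b (j + m) * b (j - i))) has_sum g j * g j) UNIV" for j
  proof -
    have "((\<lambda>(m, i). h m * b (j + m) * (h i * b (j - i))) has_sum g j * g j) UNIV"
      by (rule has_sum_times(1)[OF gs gs'])
        (use bn hn has_sum_imp_summable[OF gs] has_sum_imp_summable[OF gs'] in simp_all)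
    moreover have "(\<lambda>(m, i). h m * b (j + m) * (h i * b (j - i))) = (\<lambda>(m, i). h m * h i * (b (j + m) * b (j - i)))"
      by (auto simp: fun_eq_iff)
    ultimately show ?thesis by simp
  qed
  \<comment> \<open>On \<open>m = 0\<close> two of the three frequencies coincide with
    \<open>j - i\<close> and the third is \<open>j\<close>, so mass one makes the sum equal to
    \<open>b j\<close>; \<open>D2\<close> is the same on the axis \<open>i = 0\<close>.\<close>
  have D1: "((\<lambda>(m::int, i). of_bool (m = 0) * (b j * (b (j - i))\<^sup>2)) has_sum b j) UNIV" for j :: int
  proof (rule has_sum_pairI[where G = "\<lambda>m. of_bool (m = 0) * (b j * 1)"])
    have "bij_betw (\<lambda>i. j - i) UNIV UNIV" by (rule bij_betwI[of _ _ _ "\<lambda>k. j - k"]) auto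
    from has_sum_reindex_bij_betw[OF this, of "\<lambda>k. (b k)\<^sup>2" 1] bs
    have s: "((\<lambda>i. (b (j - i))\<^sup>2) has_sum 1) UNIV" by simp
    show "((\<lambda>i. case (m, i) of (m, i) \<Rightarrow> of_bool (m = 0) * (b j * (b (j - i))\<^sup>2)) has_sum
        of_bool (m = 0) * (b j * 1)) UNIV" for m :: int
      unfolding prod.case by (intro has_sum_cmult_right s)
  qed (use bn of_bool_zero_has_sum in simp_all)
  have D2: "((\<lambda>(m, i::int). of_bool (i = 0) * (b j * (b (j + m))\<^sup>2)) has_sum b j) UNIV" for j :: int
  proof (rule has_sum_pairI[where G = "\<lambda>m. b j * (b (j + m))\<^sup>2"])
    show "((\<lambda>m. b j * (b (j + m))\<^sup>2) has_sum b j) UNIV"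
      using has_sum_cmult_right[OF bshift[of j], of "b j"] by simp
  qed (use bn of_bool_zero_has_sum in simp_all)
  \<comment> \<open>Solves \<open>L^2 * Q * (3 * G * \<epsilon>) = 2 * (q * Q)\<close>; the 2 is
    matched by \<open>\<Omega> - 2 \<ge> 2\<close>.\<close>
  define \<epsilon> where "\<epsilon> = 2 * q / (3 * L\<^sup>2 * G)"
  have LG: "L\<^sup>2 * G > 0" using L G by simp
  have \<epsilon>: "\<epsilon> > 0" using LG q L G by (simp add: \<epsilon>_def)
  obtain X where X: "\<And>x. \<bar>x\<bar> \<ge> X \<Longrightarrow> g x \<le> \<epsilon>"
    using convolution_vanishes[OF hs has_sum_imp_summable[OF bs] hn bn \<epsilon>] unfolding g_def by blast
  have "b j \<le> q * Q" if j: "\<bar>j\<bar> \<ge> X" and Q: "\<And>x. \<bar>j\<bar> \<le> 3 * \<bar>x\<bar> \<Longrightarrow> b x \<le> Q" for j Q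
  proof -
    have Q0: "Q \<ge> 0" using Q[of j] bn[of j] by simp
    define M where "M x = (case x of (m, i) \<Rightarrow> of_bool (m = 0) * (b j * (b (j - i))\<^sup>2)) +
      (case x of (m, i) \<Rightarrow> of_bool (i = 0) * (b j * (b (j + m))\<^sup>2)) +
      L\<^sup>2 * Q * ((case x of (m, i) \<Rightarrow> h m * h i * (b (j - i) * b (j - i + m))) +
      (case x of (m, i) \<Rightarrow> h m * h i * (b (j + m) * b (j - i + m))) +
      (case x of (m, i) \<Rightarrow> h m * h i * (b (j + m) * b (j - i))))" for x
    have Ms: "(M has_sum (b j + b j + L\<^sup>2 * Q * (A j + A j + g j * g j))) UNIV"
      unfolding M_def[abs_def] by (intro has_sum_add has_sum_cmult_right D1 D2 1 2 3)
    have le: "norm (euler_term L a j x) \<le> M x" for x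
    proof (cases x)
      case (Pair m i)
      let ?p = "b (j + m) * b (j - i + m) * b (j - i)"
      have "norm (euler_term L a j x) = ?p * cmod (osc L (m * i))"
        by (simp add: Pair euler_term_def norm_mult b_def)
      also have "\<dots> \<le> ?p * (of_bool (m = 0) + of_bool (i = 0) + L\<^sup>2 * (recip m * recip i))"
        using bn by (intro mult_left_mono norm_osc_mult L) auto
      also have "\<dots> = of_bool (m = 0) * ?p + of_bool (i = 0) * ?p + L\<^sup>2 * (h m * h i * ?p)"
        by (simp add: h_def algebra_simps)
      also have "\<dots> \<le> M x"
      proof -
        have e1: "of_bool (m = 0) * ?p = of_bool (m = 0) * (b j * (b (j - i))\<^sup>2)"
          by (simp add: power2_eq_square)
        have e2: "of_bool (i = 0) * ?p = of_bool (i = 0) * (b j * (b (j + m))\<^sup>2)"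
          by (simp add: power2_eq_square)
        have "?p \<le> Q * (b (j - i) * b (j - i + m) + b (j + m) * b (j - i + m) + b (j + m) * b (j - i))"
        proof -
          let ?u = "b (j - i) * b (j - i + m)" and ?v = "b (j + m) * b (j - i + m)" and ?w = "b (j + m) * b (j - i)"
          have nn: "?u \<ge> 0" "?v \<ge> 0" "?w \<ge> 0" using bn by simp_all
          have "\<bar>j\<bar> \<le> 3 * \<bar>j + m\<bar> \<or> \<bar>j\<bar> \<le> 3 * \<bar>j - i\<bar> \<or> \<bar>j\<bar> \<le> 3 * \<bar>j - i + m\<bar>"
          proof -
            have "\<bar>j\<bar> = \<bar>(j + m + (j - i)) - (j - i + m)\<bar>" by (rule arg_cong[where f = abs]) simp
            also have "\<dots> \<le> \<bar>j + m + (j - i)\<bar> + \<bar>j - i + m\<bar>" by (rule abs_triangle_ineq4)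
            also have "\<dots> \<le> \<bar>j + m\<bar> + \<bar>j - i\<bar> + \<bar>j - i + m\<bar>"
              by (intro add_right_mono abs_triangle_ineq)
            finally have "\<bar>j\<bar> \<le> \<bar>j + m\<bar> + \<bar>j - i\<bar> + \<bar>j - i + m\<bar>" .
            moreover have "n \<le> 3 * x \<or> n \<le> 3 * y \<or> n \<le> 3 * z" if "n \<le> x + y + z" for n x y z :: int
              using that by linarith
            ultimately show ?thesis by blast
          qed
          then consider "\<bar>j\<bar> \<le> 3 * \<bar>j + m\<bar>" | "\<bar>j\<bar> \<le> 3 * \<bar>j - i\<bar>" | "\<bar>j\<bar> \<le> 3 * \<bar>j - i + m\<bar>"
            by blast
          then have "?p \<le> Q * ?u \<or> ?p \<le> Q * ?v \<or> ?p \<le> Q * ?w"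
          proof cases
            case 1
            from mult_right_mono[OF Q[OF this] nn(1)] show ?thesis by (simp add: mult_ac)
          next
            case 2
            from mult_right_mono[OF Q[OF this] nn(2)] show ?thesis by (simp add: mult_ac)
          next
            case 3
            from mult_right_mono[OF Q[OF this] nn(3)] show ?thesis by (simp add: mult_ac)
          qed
          moreover have "Q * ?u \<ge> 0" "Q * ?v \<ge> 0" "Q * ?w \<ge> 0" using nn Q0 by simp_all
          ultimately show ?thesis unfolding distrib_left by linarith
        qed
        then have "L\<^sup>2 * (h m * h i * ?p) \<le> L\<^sup>2 * (h m * h i *
            (Q * (b (j - i) * b (j - i + m) + b (j + m) * b (j - i + m) + b (j + m) * b (j - i))))"
          using hn by (intro mult_left_mono) auto
        also have "\<dots> = L\<^sup>2 * Q * (h m * h i * (b (j - i) * b (j - i + m)) +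
            h m * h i * (b (j + m) * b (j - i + m)) + h m * h i * (b (j + m) * b (j - i)))"
          by (simp only: distrib_left mult_ac)
        finally show ?thesis
          unfolding M_def Pair prod.case e1 e2 by (rule add_left_mono)
      qed
      finally show ?thesis .
    qed
    have es: "euler_term L a j summable_on UNIV"
      by (rule Infinite_Sum.abs_summable_summable,
          rule Infinite_Sum.abs_summable_on_comparison_test'[OF has_sum_imp_summable[OF Ms]]) (rule le)
    have "\<Omega> * b j = cmod (of_real \<Omega> * a j)" using \<Omega> by (simp add: norm_mult b_def)
    also have "\<dots> \<le> b j + b j + L\<^sup>2 * Q * (A j + A j + g j * g j)"
      unfolding el by (rule norm_infsum_le[OF has_sum_infsum[OF es] Ms le])
    finally have "(\<Omega> - 2) * b j \<le> L\<^sup>2 * Q * (A j + A j + g j * g j)"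
      by (simp add: algebra_simps)
    moreover have "2 * b j \<le> (\<Omega> - 2) * b j" using \<Omega> bn by (intro mult_right_mono) auto
    moreover have "L\<^sup>2 * Q * (A j + A j + g j * g j) \<le> L\<^sup>2 * Q * (3 * G * \<epsilon>)"
    proof (intro mult_left_mono)
      have "g j * g j \<le> G * g j" using gG gn by (intro mult_right_mono)
      then have "A j + A j + g j * g j \<le> 3 * G * g j" using AG[of j] by linarith
      also have "\<dots> \<le> 3 * G * \<epsilon>" using X[OF j] G by (intro mult_left_mono) auto
      finally show "A j + A j + g j * g j \<le> 3 * G * \<epsilon>" .
    qed (use Q0 in auto)
    moreover have "L\<^sup>2 * Q * (3 * G * \<epsilon>) = 2 * (q * Q)"
      using L G by (simp add: \<epsilon>_def)
    ultimately show ?thesis by linarith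
  qed
  then show ?thesis unfolding b_def by blast
qed

text \<open>Each passage from scale \<open>s\<close> to \<open>3 * s\<close> gains a factor
  \<open>q\<close>. A power of \<open>1/3\<close> for \<open>q\<close> turns geometric decay in the
  number of scales into a power of \<open>|j|\<close>.\<close>

lemma superpolynomial_decay:
  fixes b :: "int \<Rightarrow> real"
  assumes b: "\<And>j. b j \<le> 1"
    and step: "\<And>q. q > 0 \<Longrightarrow> \<exists>X. \<forall>j. \<bar>j\<bar> \<ge> X \<longrightarrow> (\<forall>Q. (\<forall>x. \<bar>j\<bar> \<le> 3 * \<bar>x\<bar> \<longrightarrow> b x \<le> Q) \<longrightarrow> b j \<le> q * Q)"
    and \<alpha>: "\<alpha> \<ge> 0"
  shows "\<exists>s0::real. \<forall>j. real_of_int \<bar>j\<bar> > s0 \<longrightarrow> b j \<le> real_of_int \<bar>j\<bar> powr (- \<alpha>)"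
proof -
  \<comment> \<open>Twice the desired exponent, because the contraction starts only at scale
    \<open>3 ^ p0\<close>. For \<open>|j|\<close> beyond \<open>3 ^ (2 * p0 + 1)\<close> at least
    half of the \<open>p + 1\<close> scales below \<open>|j|\<close> contract, which is
    \<open>real p + 1 \<le> 2 * real n\<close>.\<close>
  define N where "N = nat \<lceil>2 * \<alpha>\<rceil>"
  have N: "2 * \<alpha> \<le> real N" using \<alpha> by (simp add: N_def)
  define q :: real where "q = (1 / 3) ^ N"
  have q: "q > 0" by (simp add: q_def)
  obtain X where X: "\<And>j Q. \<bar>j\<bar> \<ge> X \<Longrightarrow> (\<And>x. \<bar>j\<bar> \<le> 3 * \<bar>x\<bar> \<Longrightarrow> b x \<le> Q) \<Longrightarrow> b j \<le> q * Q"
    using step[OF q] by blast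
  define p0 where "p0 = nat X"
  have "p0 < 3 ^ p0" by (rule power_gt_expt) simp
  then have "int p0 < int (3 ^ p0)" by (simp only: of_nat_less_iff)
  then have "int p0 < 3 ^ p0" by (simp only: of_nat_power of_nat_numeral)
  moreover have "X \<le> int p0" by (simp add: p0_def)
  ultimately have X3: "X \<le> 3 ^ p0" by linarith
  have decay: "b j \<le> q ^ n" if "\<bar>j\<bar> \<ge> 3 ^ (n + p0)" for n j
    using that
  proof (induction n arbitrary: j)
    case 0
    then show ?case using b by simp
  next
    case (Suc n)
    have "(3::int) ^ p0 \<le> 3 ^ (Suc n + p0)" by (intro power_increasing) auto
    then have "\<bar>j\<bar> \<ge> X" using Suc.prems X3 by linarith
    moreover have "b x \<le> q ^ n" if "\<bar>j\<bar> \<le> 3 * \<bar>x\<bar>" for x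
      using that Suc.prems by (intro Suc.IH) simp
    ultimately show ?case using X[of j "q ^ n"] by simp
  qed
  show ?thesis
  proof (intro exI[of _ "3 ^ (2 * p0 + 1) :: real"] allI impI)
    fix j :: int
    assume "real_of_int \<bar>j\<bar> > 3 ^ (2 * p0 + 1)"
    then have j: "\<bar>j\<bar> > 3 ^ (2 * p0 + 1)"
      by (metis of_int_less_iff of_int_numeral of_int_power)
    moreover have "(3::int) ^ (2 * p0 + 1) > 0" by simp
    ultimately have "\<bar>j\<bar> \<ge> 1" by linarith
    then have j0: "nat \<bar>j\<bar> \<ge> 1" by simp
    obtain p where p: "3 ^ p \<le> nat \<bar>j\<bar>" "nat \<bar>j\<bar> < 3 ^ (p + 1)"
      using ex_power_ivl1[of 3 "nat \<bar>j\<bar>"] j0 by auto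
    have pi: "3 ^ p \<le> \<bar>j\<bar>" "\<bar>j\<bar> < 3 ^ (p + 1)"
      using p by (simp_all add: le_nat_iff nat_less_iff)
    then have "(3::int) ^ (2 * p0 + 1) < 3 ^ (p + 1)" using j by linarith
    then have pp: "2 * p0 < p" by simp
    define n where "n = p - p0"
    have np: "p = n + p0" "real p + 1 \<le> 2 * real n" using pp by (auto simp: n_def)
    have "b j \<le> q ^ n" using pi(1) np by (intro decay) simp
    also have "q ^ n = 3 powr (- (real N * real n))"
    proof -
      have "q ^ n = 1 / 3 ^ (N * n)"
        by (simp add: q_def power_mult[symmetric] power_one_over)
      also have "\<dots> = 1 / 3 powr real (N * n)"
        by (subst powr_realpow) auto
      also have "\<dots> = 3 powr (- (real N * real n))"
        by (simp add: powr_minus_divide)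
      finally show ?thesis .
    qed
    also have "\<dots> \<le> 3 powr (- (\<alpha> * real (p + 1)))"
    proof (rule powr_mono)
      have "\<alpha> * real (p + 1) \<le> \<alpha> * (2 * real n)" using np \<alpha> by (intro mult_left_mono) auto
      also have "\<dots> = (2 * \<alpha>) * real n" by simp
      also have "\<dots> \<le> real N * real n" using N by (intro mult_right_mono) auto
      finally show "- (real N * real n) \<le> - (\<alpha> * real (p + 1))" by simp
    qed simp
    also have "\<dots> = (3 powr real (p + 1)) powr (- \<alpha>)"
      by (simp add: powr_powr mult.commute)
    also have "\<dots> = (3 ^ (p + 1)) powr (- \<alpha>)"
      by (subst powr_realpow) auto
    also have "\<dots> \<le> real_of_int \<bar>j\<bar> powr (- \<alpha>)"
    proof (rule powr_mono2')
      show "0 < real_of_int \<bar>j\<bar>" using j0 by auto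
      show "real_of_int \<bar>j\<bar> \<le> 3 ^ (p + 1)"
        using pi(2) by (metis less_imp_le of_int_le_iff of_int_numeral of_int_power)
    qed (use \<alpha> in simp)
    finally show "b j \<le> real_of_int \<bar>j\<bar> powr (- \<alpha>)" .
  qed
qed

theorem theorem1p2:
  "\<exists>K::real. K > 0 \<and> (\<exists>L0::real. L0 > 0 \<and> (\<forall>L\<ge>L0. \<exists>C::real.
     \<forall>f. f \<in> L2_torus L \<and> L2_norm L f = 1 \<and> Q_form L f f f f = complex_of_real (omega1 L) \<longrightarrow>
       (\<exists>s0::real. \<forall>k::int. real_of_int \<bar>k\<bar> > s0 \<longrightarrow>
          cmod (fourier L f k)
            \<le> C * real_of_int \<bar>k\<bar> powr (- log 3 (omega1 L / (2 * K) * L powr (1 / 2))))))"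
proof (rule exI[of _ 2], rule conjI, simp, rule exI[of _ 1], rule conjI, simp,
    intro allI impI, rule exI[of _ 1], intro allI impI)
  fix L :: real and f
  assume L1: "1 \<le> L" and f: "f \<in> L2_torus L \<and> L2_norm L f = 1 \<and> Q_form L f f f f = complex_of_real (omega1 L)"
  define a where "a = fourier L f"
  define \<omega> where "\<omega> = omega1 L"
  define \<alpha> where "\<alpha> = log 3 (\<omega> / (2 * 2) * L powr (1 / 2))"
  have L: "L > 0" using L1 by simp
  have sq: "sqint L f" using f by (auto intro: L2_torus_sqint)
  have a: "ell2 a" unfolding a_def by (rule ell2_fourier[OF L sq])
  have m: "mass a = 1" using f L2_norm_fourier[OF L sq] by (simp add: a_def)
  have qa: "quad L a a a a = of_real (\<omega> * L)"
    using f Q_form_eq_quad[OF L sq] L by (simp add: a_def \<omega>_def field_simps)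
  have "\<omega> * L = (LINT r|torus 1. (\<Sum>\<^sub>\<infinity>m. (cmod (corr (\<lambda>k. phase L r k * a k) m))\<^sup>2))"
    using integral_infsum_corr_square[OF L a] unfolding qa of_real_eq_iff by simp
  also have "\<dots> \<ge> 0" by (intro Bochner_Integration.integral_nonneg infsum_nonneg) auto
  finally have \<omega>: "\<omega> \<ge> 0" using L by (simp add: zero_le_mult_iff)
  have b1: "cmod (a j) \<le> 1" for j
  proof -
    have "(cmod (a j))\<^sup>2 \<le> mass a"
      using finite_sum_le_infsum[of "\<lambda>k. (cmod (a k))\<^sup>2" UNIV "{j}"] a by (simp add: ell2_def)
    then show ?thesis using m by (simp add: abs_square_le_1)
  qed
  have "\<exists>s0::real. \<forall>j. real_of_int \<bar>j\<bar> > s0 \<longrightarrow> cmod (a j) \<le> real_of_int \<bar>j\<bar> powr (- \<alpha>)"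
  proof (cases "\<omega> / (2 * 2) * L powr (1 / 2) \<le> 1")
    case True
    have "\<alpha> \<le> 0"
    \<comment> \<open>For \<open>\<omega> = 0\<close> the exponent is \<open>log 3 0\<close>, which
      is 0 because \<open>ln 0 = 0\<close> by convention.\<close>
    proof (cases "\<omega> = 0")
      case False
      then have "0 < \<omega> / (2 * 2) * L powr (1 / 2)" using \<omega> L by simp
      then show ?thesis using True unfolding \<alpha>_def by (subst log_le_zero_cancel_iff) auto
    qed (simp add: \<alpha>_def log_def)
    show ?thesis
    proof (intro exI[of _ 0] allI impI)
      fix j :: int
      assume "real_of_int \<bar>j\<bar> > 0"
      then have "real_of_int \<bar>j\<bar> \<ge> 1" by (simp add: abs_if split: if_splits)
      then have "real_of_int \<bar>j\<bar> powr (- \<alpha>) \<ge> 1" using \<open>\<alpha> \<le> 0\<close> by (intro ge_one_powr_ge_zero) auto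
      then show "cmod (a j) \<le> real_of_int \<bar>j\<bar> powr (- \<alpha>)" using b1[of j] by linarith
    qed
  next
    case False
    then have gt: "\<omega> * sqrt L > 4" using L by (simp add: powr_half_sqrt)
    \<comment> \<open>The claimed exponent involves \<open>\<omega> * sqrt L\<close>, whereas the
      multiplier in the Euler-Lagrange equation is \<open>\<omega> * L\<close>; the choice
      \<open>L0 = 1\<close> makes the second dominate the first.\<close>
    have "sqrt L \<le> L" using L1 by (intro real_le_lsqrt) (auto simp: power2_eq_square)
    then have "\<omega> * sqrt L \<le> \<omega> * L" using \<omega> by (intro mult_left_mono)
    then have \<Omega>: "\<omega> * L \<ge> 4" using gt by simp
    have "\<alpha> \<ge> 0" using False unfolding \<alpha>_def by (intro zero_le_log_cancel_iff[THEN iffD2]) auto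
    then show ?thesis
    proof (intro superpolynomial_decay b1)
      fix q :: real assume "q > 0"
      show "\<exists>X. \<forall>j. \<bar>j\<bar> \<ge> X \<longrightarrow> (\<forall>Q. (\<forall>x. \<bar>j\<bar> \<le> 3 * \<bar>x\<bar> \<longrightarrow> cmod (a x) \<le> Q) \<longrightarrow> cmod (a j) \<le> q * Q)"
      proof (rule ell2_maximizer_decay_step[OF L a m \<Omega> _ \<open>q > 0\<close>])
        show "of_real (\<omega> * L) * a j = infsum (euler_term L a j) UNIV" for j
          using quad_le_omega1[OF L] by (intro euler_lagrange[OF L a m qa]) (simp add: \<omega>_def)
      qed
    qed
  qed
  then show "\<exists>s0::real. \<forall>k. real_of_int \<bar>k\<bar> > s0 \<longrightarrow> cmod (fourier L f k)
      \<le> 1 * real_of_int \<bar>k\<bar> powr (- log 3 (omega1 L / (2 * 2) * L powr (1 / 2)))"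
    by (simp add: a_def \<alpha>_def \<omega>_def)
qed

end
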